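(* Let $r\ge 2$ be a fixed integer and let $F_r=F(A)$ be the free group over an alphabet $A$ with $r$ letters. The probability that a random subgroup $H$ of $F_r$ of size $n$ (chosen uniformly among the finitely many subgroups of size $n$) intersects trivially the conjugacy classes of the generators (that is, $H$ contains no conjugate $g^{-1}ag$ with $a\in A$, $g\in F_r$) tends to $e^{-r}$ when $n$ tends to infinity.
   Context: Let $A$ be an alphabet with $r$ letters. An $A$-graph is a pair $\Gamma=(V,E)$ with $E\subseteq V\times A\times V$ such that $(u,a,v),(u,a,v')\in E$ implies $v=v'$, and $(u,a,v),(u',a,v)\in E$ implies $u=u'$. It is connected if its underlying undirected graph is connected. A vertex is a leaf if it occurs at most once in the list of triples defining $E$. A pair $(\Gamma,1)$, with $1$ a distinguished vertex of $\Gamma$, is admissible if $\Gamma$ is a finite connected $A$-graph in which no vertex other than $1$ is a leaf. Each finitely generated subgroup $H$ of $F(A)$ corresponds to a unique (up to isomorphism) admissible pair $(\Gamma(H),1)$, its Stallings graph, such that a reduced word $u$ is in $H$ if and only if $u$ labels a loop at $1$ (an edge $(x,a,y)$ being read from $x$ to $y$ with label $a$ or from $y$ to $x$ with label $a^{-1}$); conversely every admissible pair is the Stallings graph of a unique finitely generated subgroup. The size of $H$ is the number of vertices of $\Gamma(H)$; there are finitely many subgroups of each size. A random subgroup of size $n$ is taken with respect to the uniform distribution on subgroups of size $n$ (the graph-based distribution). *)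

theory Defs
  imports "HOL-Probability.Probability" "HOL-Algebra.Generated_Groups"
begin

section \<open>Free groups as groups of reduced words\<close>

text \<open>The letter \<open>(a, True)\<close> stands for \<open>a\<close>, and \<open>(a, False)\<close> for its formal inverse.\<close>

type_synonym 'a letter = "'a \<times> bool"
type_synonym 'a word = "'a letter list"

definition inv_letter :: "'a letter \<Rightarrow> 'a letter" where
  "inv_letter x = (fst x, \<not> snd x)"

fun reduced_word :: "'a word \<Rightarrow> bool" where
  "reduced_word (x # y # w) \<longleftrightarrow> y \<noteq> inv_letter x \<and> reduced_word (y # w)"
| "reduced_word _ \<longleftrightarrow> True"

fun cancel_cons :: "'a letter \<Rightarrow> 'a word \<Rightarrow> 'a word" where
  "cancel_cons x [] = [x]"
| "cancel_cons x (y # w) = (if y = inv_letter x then w else x # y # w)"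

text \<open>For reduced \<open>u\<close> and \<open>v\<close>, the reduced form of the concatenation \<open>u @ v\<close>.\<close>

definition word_mult :: "'a word \<Rightarrow> 'a word \<Rightarrow> 'a word" where
  "word_mult u v = foldr cancel_cons u v"

definition free_group :: "'a set \<Rightarrow> 'a word monoid" where
  "free_group A =
     \<lparr>carrier = {w. reduced_word w \<and> fst ` set w \<subseteq> A}, monoid.mult = word_mult, one = []\<rparr>"

definition generator :: "'a \<Rightarrow> 'a word" where
  "generator a = [(a, True)]"

lemma inv_letter_inv_letter [simp]: "inv_letter (inv_letter x) = x"
  by (simp add: inv_letter_def)

lemma fst_inv_letter [simp]: "fst (inv_letter x) = fst x"
  by (simp add: inv_letter_def)

lemma reduced_ConsD: "reduced_word (x # w) \<Longrightarrow> reduced_word w"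
  by (cases w) auto

lemma reduced_cancel_cons: "reduced_word w \<Longrightarrow> reduced_word (cancel_cons x w)"
  by (cases w) (auto dest: reduced_ConsD)

lemma cancel_cons_reduced: "reduced_word (x # w) \<Longrightarrow> cancel_cons x w = x # w"
  by (cases w) auto

lemma cancel_cons_inv: "reduced_word w \<Longrightarrow> cancel_cons x (cancel_cons (inv_letter x) w) = w"
  by (cases w) (auto simp: cancel_cons_reduced)

lemma letters_cancel_cons: "fst ` set (cancel_cons x w) \<subseteq> insert (fst x) (fst ` set w)"
  by (cases w) auto

lemma reduced_word_mult: "reduced_word v \<Longrightarrow> reduced_word (word_mult u v)"
  unfolding word_mult_def by (induction u) (auto intro: reduced_cancel_cons)

lemma letters_word_mult: "fst ` set (word_mult u v) \<subseteq> fst ` set u \<union> fst ` set v"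
proof (induction u)
  case Nil
  show ?case by (simp add: word_mult_def)
next
  case (Cons x u)
  have "word_mult (x # u) v = cancel_cons x (word_mult u v)"
    by (simp add: word_mult_def)
  then have "fst ` set (word_mult (x # u) v) \<subseteq> insert (fst x) (fst ` set (word_mult u v))"
    by (simp only: letters_cancel_cons)
  also have "\<dots> \<subseteq> insert (fst x) (fst ` set u \<union> fst ` set v)"
    using Cons.IH by (rule Set.insert_mono)
  also have "\<dots> = fst ` set (x # u) \<union> fst ` set v"
    by simp
  finally show ?case .
qed

lemma word_mult_cancel_cons:
  "reduced_word w \<Longrightarrow> word_mult (cancel_cons x v) w = cancel_cons x (word_mult v w)"
proof (cases v)
  case (Cons y v')
  assume "reduced_word w"
  then show ?thesis
    using Cons reduced_word_mult[of w v'] cancel_cons_inv[of "word_mult v' w" x]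
    by (simp add: word_mult_def)
qed (simp add: word_mult_def)

lemma word_mult_assoc:
  assumes "reduced_word w"
  shows "word_mult (word_mult u v) w = word_mult u (word_mult v w)"
proof (induction u)
  case Nil
  show ?case by (simp add: word_mult_def)
next
  case (Cons x u)
  have "word_mult (word_mult (x # u) v) w = word_mult (cancel_cons x (word_mult u v)) w"
    by (simp add: word_mult_def)
  also have "\<dots> = cancel_cons x (word_mult (word_mult u v) w)"
    using assms by (rule word_mult_cancel_cons)
  also have "\<dots> = word_mult (x # u) (word_mult v w)"
    using Cons by (simp add: word_mult_def)
  finally show ?case .
qed

lemma word_left_inverse:
  "\<exists>v. reduced_word v \<and> fst ` set v \<subseteq> fst ` set u \<and> word_mult v u = []" if "reduced_word u"
  using that
proof (induction u)
  case Nil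
  show ?case by (rule exI[of _ "[]"]) (simp add: word_mult_def)
next
  case (Cons x u)
  obtain v where v: "reduced_word v" "fst ` set v \<subseteq> fst ` set u" "word_mult v u = []"
    using Cons reduced_ConsD by blast
  let ?v = "word_mult v [inv_letter x]"
  have "word_mult ?v (x # u) = word_mult v (word_mult [inv_letter x] (x # u))"
    using Cons.prems by (rule word_mult_assoc)
  also have "\<dots> = []"
    using v by (simp add: word_mult_def)
  finally have "word_mult ?v (x # u) = []" .
  moreover have "fst ` set ?v \<subseteq> fst ` set v \<union> {fst x}"
    using letters_word_mult[of v "[inv_letter x]"] by simp
  then have "fst ` set ?v \<subseteq> fst ` set (x # u)"
    using v(2) by (simp only: list.set image_insert) blast
  moreover have "reduced_word ?v" by (simp add: reduced_word_mult)
  ultimately show ?case by (intro exI[of _ ?v] conjI)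
qed

lemma group_free_group: "group (free_group A)"
proof (rule groupI)
  fix u v assume "u \<in> carrier (free_group A)" "v \<in> carrier (free_group A)"
  then have "reduced_word v" "fst ` set u \<union> fst ` set v \<subseteq> A"
    by (auto simp: free_group_def)
  then have "reduced_word (word_mult u v)"
    using reduced_word_mult by simp
  moreover have "fst ` set (word_mult u v) \<subseteq> A"
    using letters_word_mult \<open>fst ` set u \<union> fst ` set v \<subseteq> A\<close> by (rule subset_trans)
  ultimately show "u \<otimes>\<^bsub>free_group A\<^esub> v \<in> carrier (free_group A)"
    by (simp add: free_group_def)
next
  fix u assume "u \<in> carrier (free_group A)"
  then have "reduced_word u" "fst ` set u \<subseteq> A" by (auto simp: free_group_def)
  moreover from this obtain v where
      "reduced_word v" "fst ` set v \<subseteq> fst ` set u" "word_mult v u = []"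
    using word_left_inverse by blast
  ultimately have "v \<in> carrier (free_group A)" "v \<otimes>\<^bsub>free_group A\<^esub> u = \<one>\<^bsub>free_group A\<^esub>"
    by (auto simp: free_group_def)
  then show "\<exists>v\<in>carrier (free_group A). v \<otimes>\<^bsub>free_group A\<^esub> u = \<one>\<^bsub>free_group A\<^esub>"
    by (rule rev_bexI)
next
  fix u v w
  assume "w \<in> carrier (free_group A)"
  then show "u \<otimes>\<^bsub>free_group A\<^esub> v \<otimes>\<^bsub>free_group A\<^esub> w =
    u \<otimes>\<^bsub>free_group A\<^esub> (v \<otimes>\<^bsub>free_group A\<^esub> w)"
    by (simp add: free_group_def word_mult_assoc)
qed (simp_all add: free_group_def word_mult_def)

section \<open>Stallings graphs\<close>

definition is_graph :: "'a set \<Rightarrow> 'v set \<Rightarrow> ('v \<times> 'a \<times> 'v) set \<Rightarrow> bool" where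
  "is_graph A V E \<longleftrightarrow>
     E \<subseteq> V \<times> A \<times> V \<and>
     (\<forall>u a v v'. (u, a, v) \<in> E \<and> (u, a, v') \<in> E \<longrightarrow> v = v') \<and>
     (\<forall>u u' a v. (u, a, v) \<in> E \<and> (u', a, v) \<in> E \<longrightarrow> u = u')"

definition adjacency :: "('v \<times> 'a \<times> 'v) set \<Rightarrow> ('v \<times> 'v) set" where
  "adjacency E = {(u, v). \<exists>a. (u, a, v) \<in> E \<or> (v, a, u) \<in> E}"

definition is_connected :: "'v set \<Rightarrow> ('v \<times> 'a \<times> 'v) set \<Rightarrow> bool" where
  "is_connected V E \<longleftrightarrow> (\<forall>u\<in>V. \<forall>v\<in>V. (u, v) \<in> (adjacency E)\<^sup>*)"

text \<open>Occurrences in the list of triples; a loop \<open>(v, a, v)\<close> contributes two occurrences of \<open>v\<close>.\<close>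

definition occurrences :: "('v \<times> 'a \<times> 'v) set \<Rightarrow> 'v \<Rightarrow> nat" where
  "occurrences E v = card {(x, a, y) \<in> E. x = v} + card {(x, a, y) \<in> E. y = v}"

definition is_leaf :: "('v \<times> 'a \<times> 'v) set \<Rightarrow> 'v \<Rightarrow> bool" where
  "is_leaf E v \<longleftrightarrow> occurrences E v \<le> 1"

definition admissible ::
    "'a set \<Rightarrow> 'v set \<Rightarrow> ('v \<times> 'a \<times> 'v) set \<Rightarrow> 'v \<Rightarrow> bool" where
  "admissible A V E p \<longleftrightarrow>
     is_graph A V E \<and> finite V \<and> is_connected V E \<and> p \<in> V \<and>
     (\<forall>v\<in>V. v \<noteq> p \<longrightarrow> \<not> is_leaf E v)"

text \<open>\<open>reads E p w q\<close>: the word \<open>w\<close> labels a path from \<open>p\<close> to \<open>q\<close>.\<close>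

fun reads :: "('v \<times> 'a \<times> 'v) set \<Rightarrow> 'v \<Rightarrow> 'a word \<Rightarrow> 'v \<Rightarrow> bool" where
  "reads E p [] q \<longleftrightarrow> p = q"
| "reads E p ((a, True) # w) q \<longleftrightarrow> (\<exists>p'. (p, a, p') \<in> E \<and> reads E p' w q)"
| "reads E p ((a, False) # w) q \<longleftrightarrow> (\<exists>p'. (p', a, p) \<in> E \<and> reads E p' w q)"

definition is_stallings_graph ::
    "'a set \<Rightarrow> 'a word set \<Rightarrow> 'v set \<Rightarrow> ('v \<times> 'a \<times> 'v) set \<Rightarrow> 'v \<Rightarrow> bool" where
  "is_stallings_graph A H V E p \<longleftrightarrow>
     admissible A V E p \<and> (\<forall>u\<in>carrier (free_group A). u \<in> H \<longleftrightarrow> reads E p u p)"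

text \<open>
  The Stallings graph is determined only up to isomorphism; since it is finite, a representative
  can be chosen with natural numbers as vertices.  The choice is meaningful only for finitely
  generated subgroups.
\<close>

definition stallings_graph ::
    "'a set \<Rightarrow> 'a word set \<Rightarrow> nat set \<times> (nat \<times> 'a \<times> nat) set \<times> nat" where
  "stallings_graph A H = (SOME (V, E, p). is_stallings_graph A H V E p)"

definition subgroup_size :: "'a set \<Rightarrow> 'a word set \<Rightarrow> nat" where
  "subgroup_size A H = card (fst (stallings_graph A H))"

section \<open>Random subgroups\<close>

definition finitely_generated_subgroup :: "'a set \<Rightarrow> 'a word set \<Rightarrow> bool" where
  "finitely_generated_subgroup A H \<longleftrightarrow>
     subgroup H (free_group A) \<and>
     (\<exists>S. finite S \<and> S \<subseteq> carrier (free_group A) \<and> H = generate (free_group A) S)"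

definition subgroups_of_size :: "'a set \<Rightarrow> nat \<Rightarrow> 'a word set set" where
  "subgroups_of_size A n = {H. finitely_generated_subgroup A H \<and> subgroup_size A H = n}"

text \<open>
  The graph-based distribution.  For finite \<open>A\<close> there are finitely many subgroups of size \<open>n\<close>,
  and at least one if \<open>A\<close> is nonempty and \<open>n \<ge> 1\<close>; no subgroup has size \<open>0\<close>, so the value at
  \<open>n = 0\<close> carries no meaning.
\<close>

definition random_subgroup :: "'a set \<Rightarrow> nat \<Rightarrow> 'a word set pmf" where
  "random_subgroup A n = pmf_of_set (subgroups_of_size A n)"

definition avoids_generator_conjugates :: "'a set \<Rightarrow> 'a word set \<Rightarrow> bool" where
  "avoids_generator_conjugates A H \<longleftrightarrow>
     (\<forall>a\<in>A. \<forall>g\<in>carrier (free_group A).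
        inv\<^bsub>free_group A\<^esub> g \<otimes>\<^bsub>free_group A\<^esub> generator a \<otimes>\<^bsub>free_group A\<^esub> g \<notin> H)"

end

theory Submission
  imports Defs
begin

text \<open>
  Subgroups of size \<open>n\<close> are counted through labelled graphs.  A Stallings graph is rigid: an
  isomorphism fixing the root is determined by the root, because every vertex is reached by a word and
  words are read deterministically.  Hence a subgroup of size \<open>n\<close> has exactly \<open>(n - 1)!\<close> Stallings
  graphs with vertex set \<open>{..<n}\<close> and root \<open>0\<close> (\<open>card_relabellings\<close>), and a uniformly random subgroup
  may be replaced by a uniformly random admissible graph on \<open>{..<n}\<close>.  This uses that Stallings graphs exist
  (\<open>stallings_graph_of_cosets\<close>, by a finite piece of the Schreier coset graph) and are unique up to
  isomorphism (\<open>stallings_graph_unique\<close>, which rests on \<open>edge_on_reduced_loop\<close>: every edge of an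
  admissible graph lies on a reduced loop at the root).  A subgroup contains a conjugate of the
  generator \<open>a\<close> if and only if its graph has a loop \<open>(v, a, v)\<close>
  (\<open>avoids_generator_conjugates_iff_loop_free\<close>).  What remains is the probability that a random
  admissible graph has no loops.

  A graph on \<open>{..<n}\<close>, connected or not, is an arbitrary family of \<open>r\<close> partial injections of \<open>{..<n}\<close>.  Let
  \<open>I n\<close> be the number of partial injections and \<open>a n = I n / n!\<close>.  The one analytic fact behind all the
  estimates is that a given point lies outside the domain of a random partial injection with probability
  at most \<open>1 / sqrt n\<close> (\<open>vacancy_le\<close>), proved by induction from a recurrence.  As
  \<open>a (n - 1) / a n\<close> is one minus this probability, \<open>a\<close> is increasing and
  \<open>a (n - k) / a n \<longlonglongrightarrow> 1\<close> for every fixed \<open>k\<close>.  Three consequences follow.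

    \<^item> By inclusion-exclusion the probability of having no fixed point is the sum over \<open>k \<le> n\<close> of
      \<open>(- 1)\<^sup>k / k! * (a (n - k) / a n)\<close>, which tends to \<open>exp (- 1)\<close> by dominated convergence; for \<open>r\<close>
      independent letters the limit is \<open>exp (- r)\<close> (\<open>loop_free_graph_fraction\<close>).

    \<^item> A leaf is avoided entirely by one of two given letters and is vacant on at least one side for the other,
      which has probability at most \<open>4 * n powr (- 3/2)\<close>.  So the expected number of leaves
      tends to \<open>0\<close> (\<open>leaf_graph_fraction\<close>).

    \<^item> In a disconnected graph some set of \<open>k \<le> n / 2\<close> vertices is separated from the rest.  The probability
      of this is at most the sum over \<open>k\<close> of \<open>(a k)\<^sup>2 / (n choose k)\<close>, which tends to \<open>0\<close> by
      dominated convergence: each term does, \<open>n choose k \<ge> 2 ^ k\<close>, and \<open>a k\<close> grows subexponentially (\<open>disconnected_graph_fraction\<close>).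

  So a random graph is admissible with probability tending to \<open>1\<close>, and conditioning on
  admissibility does not change the limit \<open>exp (- r)\<close>.
\<close>

section \<open>Counting partial injections\<close>

definition partial_injections :: "'v set \<Rightarrow> 'w set \<Rightarrow> ('v \<times> 'w) set set" where
  "partial_injections X Y = {R. R \<subseteq> X \<times> Y \<and> single_valued R \<and> single_valued (R\<inverse>)}"

text \<open>
  The number of partial injections from \<open>m\<close> points to \<open>n\<close> points: the last of the \<open>m\<close> points
  is either outside the domain or sent to one of the \<open>n\<close> points, which is then used up.
\<close>

fun pinj_count :: "nat \<Rightarrow> nat \<Rightarrow> nat" where
  "pinj_count 0 n = 1"
| "pinj_count (Suc m) n = pinj_count m n + n * pinj_count m (n - 1)"

lemma finite_partial_injections: "finite X \<Longrightarrow> finite Y \<Longrightarrow> finite (partial_injections X Y)"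
  by (rule finite_subset[of _ "Pow (X \<times> Y)"]) (auto simp: partial_injections_def)

text \<open>
  Partial injections between disjoint blocks do not interfere, so they can be glued freely.  Both counting
  principles below (block-diagonal relations, and extensions of a given one) are instances.
\<close>

lemma partial_injections_Un_iff:
  assumes "X \<inter> X' = {}" "Y \<inter> Y' = {}" "R \<subseteq> X \<times> Y" "R' \<subseteq> X' \<times> Y'"
  shows "R \<union> R' \<in> partial_injections (X \<union> X') (Y \<union> Y') \<longleftrightarrow>
    R \<in> partial_injections X Y \<and> R' \<in> partial_injections X' Y'"
proof -
  have "single_valued (R \<union> R') \<longleftrightarrow> single_valued R \<and> single_valued R'"
    using assms unfolding single_valued_def by (safe; blast)
  moreover have "single_valued ((R \<union> R')\<inverse>) \<longleftrightarrow> single_valued (R\<inverse>) \<and> single_valued (R'\<inverse>)"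
    using assms unfolding single_valued_def by (safe; blast)
  ultimately show ?thesis
    using assms unfolding partial_injections_def by blast
qed

lemma card_partial_injections_split:
  assumes "X \<inter> X' = {}" "Y \<inter> Y' = {}"
  shows "card {R \<in> partial_injections (X \<union> X') (Y \<union> Y'). R \<subseteq> X \<times> Y \<union> X' \<times> Y'} =
    card (partial_injections X Y) * card (partial_injections X' Y')"
proof -
  have "bij_betw (\<lambda>(R, R'). R \<union> R') (partial_injections X Y \<times> partial_injections X' Y')
      {R \<in> partial_injections (X \<union> X') (Y \<union> Y'). R \<subseteq> X \<times> Y \<union> X' \<times> Y'}"
  proof (rule bij_betw_byWitness[where f' = "\<lambda>R. (R \<inter> X \<times> Y, R \<inter> X' \<times> Y')"])
    show "(\<lambda>(R, R'). R \<union> R') ` (partial_injections X Y \<times> partial_injections X' Y') \<subseteq>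
        {R \<in> partial_injections (X \<union> X') (Y \<union> Y'). R \<subseteq> X \<times> Y \<union> X' \<times> Y'}"
    proof (rule image_subsetI)
      fix RR assume "RR \<in> partial_injections X Y \<times> partial_injections X' Y'"
      then obtain R R' where RR: "RR = (R, R')" "R \<in> partial_injections X Y"
          "R' \<in> partial_injections X' Y'"
        by blast
      then have sub: "R \<subseteq> X \<times> Y" "R' \<subseteq> X' \<times> Y'" by (auto simp: partial_injections_def)
      then have "R \<union> R' \<in> partial_injections (X \<union> X') (Y \<union> Y')"
        using partial_injections_Un_iff[OF assms] RR by blast
      then show "(\<lambda>(R, R'). R \<union> R') RR \<in>
          {R \<in> partial_injections (X \<union> X') (Y \<union> Y'). R \<subseteq> X \<times> Y \<union> X' \<times> Y'}"
        using sub RR(1) by auto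
    qed
    show "(\<lambda>R. (R \<inter> X \<times> Y, R \<inter> X' \<times> Y')) `
        {R \<in> partial_injections (X \<union> X') (Y \<union> Y'). R \<subseteq> X \<times> Y \<union> X' \<times> Y'}
        \<subseteq> partial_injections X Y \<times> partial_injections X' Y'"
    proof (rule image_subsetI)
      fix R assume "R \<in> {R \<in> partial_injections (X \<union> X') (Y \<union> Y'). R \<subseteq> X \<times> Y \<union> X' \<times> Y'}"
      then have "R \<inter> X \<times> Y \<union> R \<inter> X' \<times> Y' = R" "R \<in> partial_injections (X \<union> X') (Y \<union> Y')"
        by blast+
      then show "(R \<inter> X \<times> Y, R \<inter> X' \<times> Y') \<in> partial_injections X Y \<times> partial_injections X' Y'"
        using partial_injections_Un_iff[OF assms, of "R \<inter> X \<times> Y" "R \<inter> X' \<times> Y'"] by auto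
    qed
    show "\<forall>RR\<in>partial_injections X Y \<times> partial_injections X' Y'.
        (\<lambda>R. (R \<inter> X \<times> Y, R \<inter> X' \<times> Y')) ((\<lambda>(R, R'). R \<union> R') RR) = RR"
    proof (rule ballI)
      fix RR assume "RR \<in> partial_injections X Y \<times> partial_injections X' Y'"
      then obtain R R' where RR: "RR = (R, R')" and "R \<subseteq> X \<times> Y" "R' \<subseteq> X' \<times> Y'"
        by (auto simp: partial_injections_def)
      then have "(R \<union> R') \<inter> X \<times> Y = R" "(R \<union> R') \<inter> X' \<times> Y' = R'" using assms by blast+
      then show "(\<lambda>R. (R \<inter> X \<times> Y, R \<inter> X' \<times> Y')) ((\<lambda>(R, R'). R \<union> R') RR) = RR"
        by (simp add: RR)
    qed
    show "\<forall>R\<in>{R \<in> partial_injections (X \<union> X') (Y \<union> Y'). R \<subseteq> X \<times> Y \<union> X' \<times> Y'}.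
        (\<lambda>(R, R'). R \<union> R') (R \<inter> X \<times> Y, R \<inter> X' \<times> Y') = R"
    proof (rule ballI)
      fix R assume "R \<in> {R \<in> partial_injections (X \<union> X') (Y \<union> Y'). R \<subseteq> X \<times> Y \<union> X' \<times> Y'}"
      then have "R \<subseteq> X \<times> Y \<union> X' \<times> Y'" by simp
      then have "R \<inter> X \<times> Y \<union> R \<inter> X' \<times> Y' = R" by blast
      then show "(\<lambda>(R, R'). R \<union> R') (R \<inter> X \<times> Y, R \<inter> X' \<times> Y') = R" by simp
    qed
  qed
  from bij_betw_same_card[OF this] show ?thesis
    by (simp add: card_cartesian_product)
qed

text \<open>
  The given bijection \<open>Q\<close> saturates its rows and columns, so a partial injection containing it is
  block-diagonal and is determined by its other block.
\<close>

lemma card_partial_injections_extending: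
  assumes "Q \<in> partial_injections X Y" "X \<inter> X' = {}" "Y \<inter> Y' = {}" "Domain Q = X" "Range Q = Y"
  shows "card {R \<in> partial_injections (X \<union> X') (Y \<union> Y'). Q \<subseteq> R} = card (partial_injections X' Y')"
proof -
  have Q: "Q \<subseteq> X \<times> Y" using assms(1) by (auto simp: partial_injections_def)
  have "bij_betw (\<lambda>R'. Q \<union> R') (partial_injections X' Y')
      {R \<in> partial_injections (X \<union> X') (Y \<union> Y'). Q \<subseteq> R}"
  proof (rule bij_betw_byWitness[where f' = "\<lambda>R. R - Q"])
    show "(\<lambda>R'. Q \<union> R') ` partial_injections X' Y' \<subseteq>
        {R \<in> partial_injections (X \<union> X') (Y \<union> Y'). Q \<subseteq> R}"
    proof safe
      fix R' assume R: "R' \<in> partial_injections X' Y'"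
      then have "R' \<subseteq> X' \<times> Y'" by (auto simp: partial_injections_def)
      then show "Q \<union> R' \<in> partial_injections (X \<union> X') (Y \<union> Y')"
        using partial_injections_Un_iff[OF assms(2,3) Q] R assms(1) by blast
    qed
    show "(\<lambda>R. R - Q) ` {R \<in> partial_injections (X \<union> X') (Y \<union> Y'). Q \<subseteq> R}
        \<subseteq> partial_injections X' Y'"
    proof (rule image_subsetI)
      fix R assume "R \<in> {R \<in> partial_injections (X \<union> X') (Y \<union> Y'). Q \<subseteq> R}"
      then have R: "R \<in> partial_injections (X \<union> X') (Y \<union> Y')" "Q \<subseteq> R" by auto
      have sv: "single_valued R" "single_valued (R\<inverse>)" "R \<subseteq> (X \<union> X') \<times> (Y \<union> Y')"
        using R by (auto simp: partial_injections_def)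
      have "R - Q \<subseteq> X' \<times> Y'"
      proof safe
        fix x y assume xy: "(x, y) \<in> R" "(x, y) \<notin> Q"
        have "x \<notin> X"
        proof
          assume "x \<in> X"
          then obtain z where "(x, z) \<in> Q" using assms(4) by blast
          then show False using xy R(2) sv(1) by (metis single_valuedD subsetD)
        qed
        then show "x \<in> X'" using xy sv by blast
        have "y \<notin> Y"
        proof
          assume "y \<in> Y"
          then obtain z where "(z, y) \<in> Q" using assms(5) by blast
          then show False using xy R(2) sv(2) by (metis single_valuedD subsetD converse_iff)
        qed
        then show "y \<in> Y'" using xy sv by blast
      qed
      moreover have "Q \<union> (R - Q) = R" using R by blast
      ultimately show "R - Q \<in> partial_injections X' Y'"
        using partial_injections_Un_iff[OF assms(2,3) Q] R by metis
    qed
    show "\<forall>R\<in>partial_injections X' Y'. Q \<union> R - Q = R"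
    proof (rule ballI)
      fix R assume "R \<in> partial_injections X' Y'"
      then have "R \<subseteq> X' \<times> Y'" by (simp add: partial_injections_def)
      then show "Q \<union> R - Q = R" using Q assms(2) by blast
    qed
  qed blast
  from bij_betw_same_card[OF this] show ?thesis by simp
qed

lemma partial_injections_avoiding:
  "{R \<in> partial_injections X Y. x \<notin> Domain R} = partial_injections (X - {x}) Y"
  by (auto simp: partial_injections_def)

lemma partial_injections_converse:
  "R\<inverse> \<in> partial_injections Y X \<longleftrightarrow> R \<in> partial_injections X Y"
  by (auto simp: partial_injections_def)

lemma card_partial_injections_swap:
  "card (partial_injections X Y) = card (partial_injections Y X)"
  by (rule bij_betw_same_card[of converse], rule bij_betw_byWitness[where f' = converse])
    (auto simp: partial_injections_converse)

lemma card_partial_injections: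
  fixes X :: "'v set" and Y :: "'w set"
  assumes "finite X" "finite Y"
  shows "card (partial_injections X Y) = pinj_count (card X) (card Y)"
  using assms
proof (induction X arbitrary: Y rule: finite_induct)
  case empty
  have "partial_injections ({} :: 'v set) Y = {{}}" by (auto simp: partial_injections_def)
  then show ?case by simp
next
  case (insert x X)
  let ?P = "partial_injections (insert x X) Y"
  have fin: "finite ?P" using insert by (intro finite_partial_injections) auto
  have split: "?P = {R \<in> ?P. x \<notin> Domain R} \<union> (\<Union>y\<in>Y. {R \<in> ?P. {(x, y)} \<subseteq> R})"
    by (auto simp: partial_injections_def)
  have "card {R \<in> ?P. {(x, y)} \<subseteq> R} = pinj_count (card X) (card Y - 1)" if "y \<in> Y" for y
  proof -
    have "card {R \<in> partial_injections ({x} \<union> X) ({y} \<union> (Y - {y})). {(x, y)} \<subseteq> R} =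
        card (partial_injections X (Y - {y}))"
      using insert.hyps by (intro card_partial_injections_extending)
        (auto simp: partial_injections_def single_valued_def)
    also have "\<dots> = pinj_count (card X) (card Y - 1)"
      using insert that by simp
    finally show ?thesis using that by (simp add: insert_absorb)
  qed
  moreover have "card (\<Union>y\<in>Y. {R \<in> ?P. {(x, y)} \<subseteq> R}) = (\<Sum>y\<in>Y. card {R \<in> ?P. {(x, y)} \<subseteq> R})"
  proof (intro card_UN_disjoint ballI impI)
    show "finite {R \<in> ?P. {(x, y)} \<subseteq> R}" for y using fin by simp
  qed (use insert.prems in \<open>auto simp: partial_injections_def single_valued_def\<close>)
  moreover have "card {R \<in> ?P. x \<notin> Domain R} = pinj_count (card X) (card Y)"
    using insert by (simp add: partial_injections_avoiding)
  moreover have "card ?P = card {R \<in> ?P. x \<notin> Domain R} + card (\<Union>y\<in>Y. {R \<in> ?P. {(x, y)} \<subseteq> R})"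
  proof (subst split, rule card_Un_disjoint)
    show "finite (\<Union>y\<in>Y. {R \<in> ?P. {(x, y)} \<subseteq> R})" using fin insert by auto
  qed (use fin in auto)
  ultimately show ?case using insert by simp
qed

text \<open>
  The recursion treats its arguments asymmetrically; the symmetry comes from taking converses.
\<close>

lemma pinj_count_swap: "pinj_count m n = pinj_count n m"
  using card_partial_injections[of "{..<m}" "{..<n}"] card_partial_injections[of "{..<n}" "{..<m}"]
    card_partial_injections_swap[of "{..<m}" "{..<n}"] by simp

lemma pinj_count_pos: "pinj_count m n > 0"
  by (induction m n rule: pinj_count.induct) auto

section \<open>Vacant points of a random partial injection\<close>

text \<open>
  The probability that a given one of \<open>n\<close> points is outside the domain of a uniformly random partial
  injection.  It carries no meaning at \<open>n = 0\<close>.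
\<close>

definition vacancy :: "nat \<Rightarrow> real" where
  "vacancy n = pinj_count (n - 1) n / pinj_count n n"

text \<open>
  Both sides count the partial injections with a given point in the domain, on the left by the \<open>n + 1\<close> possible
  values of that point.
\<close>

lemma vacancy_Suc_pred:
  "real (Suc n) * pinj_count n n = (1 - vacancy (Suc n)) * pinj_count (Suc n) (Suc n)"
proof -
  have "vacancy (Suc n) * pinj_count (Suc n) (Suc n) = pinj_count n (Suc n)"
    using pinj_count_pos[of "Suc n" "Suc n"] unfolding vacancy_def by (simp del: pinj_count.simps)
  moreover have "real (pinj_count (Suc n) (Suc n)) = pinj_count n (Suc n) + real (Suc n) * pinj_count n n"
    by (simp add: algebra_simps)
  ultimately show ?thesis by (simp only: left_diff_distrib) simp
qed

lemma vacancy_nonneg: "0 \<le> vacancy n"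
  by (simp add: vacancy_def)

lemma vacancy_less_1: "vacancy (Suc n) < 1"
proof -
  have "0 < (1 - vacancy (Suc n)) * pinj_count (Suc n) (Suc n)"
    unfolding vacancy_Suc_pred[symmetric] using pinj_count_pos[of n n] by simp
  then show ?thesis using pinj_count_pos[of "Suc n" "Suc n"]
    by (simp add: zero_less_mult_iff del: pinj_count.simps)
qed

text \<open>
  Count the partial injections whose domain misses a given point \<open>x\<close> by what happens to \<open>x\<close> on the other
  side: either \<open>x\<close> is also not a value, or it is the value of one of the remaining points.  Both cases
  reduce to one size less.
\<close>

lemma vacancy_recurrence:
  "real (Suc (Suc n)) * vacancy (Suc (Suc n)) =
    (1 - vacancy (Suc (Suc n))) * (1 + real (Suc n) * vacancy (Suc n))"
proof -
  define J K where "J = real (pinj_count (Suc n) (Suc n))"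
    and "K = real (pinj_count (Suc (Suc n)) (Suc (Suc n)))"
  have pos: "J > 0" "K > 0" using pinj_count_pos by (auto simp: J_def K_def simp del: pinj_count.simps)
  have "pinj_count (Suc n) (Suc (Suc n)) = pinj_count (Suc (Suc n)) (Suc n)"
    by (rule pinj_count_swap)
  also have "\<dots> = pinj_count (Suc n) (Suc n) + Suc n * pinj_count (Suc n) n"
    by simp
  also have "pinj_count (Suc n) n = pinj_count n (Suc n)" by (rule pinj_count_swap)
  finally have "real (pinj_count (Suc n) (Suc (Suc n))) = J + real (Suc n) * pinj_count n (Suc n)"
    unfolding J_def by (metis of_nat_add of_nat_mult)
  moreover have "real (pinj_count (Suc n) (Suc (Suc n))) = vacancy (Suc (Suc n)) * K"
    using pos unfolding vacancy_def K_def by simp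
  moreover have "real (pinj_count n (Suc n)) = vacancy (Suc n) * J"
    using pos unfolding vacancy_def J_def by simp
  ultimately have 1: "vacancy (Suc (Suc n)) * K = J * (1 + real (Suc n) * vacancy (Suc n))"
    by (simp only: ring_distribs ac_simps mult_1_right)
  have 2: "real (Suc (Suc n)) * J = (1 - vacancy (Suc (Suc n))) * K"
    unfolding J_def K_def by (rule vacancy_Suc_pred)
  have "(real (Suc (Suc n)) * vacancy (Suc (Suc n))) * K =
      (real (Suc (Suc n)) * J) * (1 + real (Suc n) * vacancy (Suc n))"
    using 1 by (simp only: mult.assoc)
  also have "\<dots> = ((1 - vacancy (Suc (Suc n))) * (1 + real (Suc n) * vacancy (Suc n))) * K"
    unfolding 2 by (simp only: ac_simps)
  finally show ?thesis using pos by (simp only: mult_cancel_right) auto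
qed

text \<open>
  Induction on the recurrence: with \<open>s\<close>, \<open>t\<close> the square roots of the consecutive sizes, \<open>v \<le> 1 / s\<close> turns
  it into \<open>t\<^sup>2 * w \<le> (1 - w) * (1 + t)\<close>, which already forces \<open>w \<le> 1 / t\<close>.
\<close>

lemma vacancy_le: "vacancy (Suc n) \<le> 1 / sqrt (Suc n)"
proof (induction n)
  case 0
  show ?case using vacancy_less_1[of 0] by simp
next
  case (Suc n)
  define v w s t where vw: "v = vacancy (Suc n)" "w = vacancy (Suc (Suc n))"
    and s: "s = sqrt (real (Suc n))" and t: "t = sqrt (real (Suc (Suc n)))"
  have st: "s > 0" "s < t" "real (Suc n) = s\<^sup>2" "real (Suc (Suc n)) = t\<^sup>2"
    by (auto simp: s t)
  then have ts: "t\<^sup>2 = s\<^sup>2 + 1" by simp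
  have w: "w < 1" "w \<ge> 0" unfolding vw using vacancy_less_1 vacancy_nonneg by auto
  have "v \<le> 1 / s" using Suc unfolding vw s .
  then have "s\<^sup>2 * v \<le> s" using st(1) by (simp add: field_simps power2_eq_square)
  then have "1 + s\<^sup>2 * v \<le> 1 + t" using st by simp
  moreover have "t\<^sup>2 * w = (1 - w) * (1 + s\<^sup>2 * v)"
    using vacancy_recurrence[of n] unfolding vw[symmetric] st(3,4) .
  ultimately have "t\<^sup>2 * w \<le> (1 - w) * (1 + t)"
    using w by (simp add: mult_left_mono)
  then have "w * t * (t + 1) + w \<le> t + 1" by (simp add: power2_eq_square algebra_simps)
  then have "w * t * (t + 1) \<le> 1 * (t + 1)" using w by simp
  then have "w * t \<le> 1" using st by (subst (asm) mult_le_cancel_right) auto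
  then show ?case using st unfolding vw(2)[symmetric] t[symmetric]
    by (simp add: field_simps)
qed

lemma vacancy_tendsto_0: "vacancy \<longlonglongrightarrow> 0"
proof -
  have "(\<lambda>n. vacancy (Suc n)) \<longlonglongrightarrow> 0"
  proof (rule tendsto_sandwich[OF _ _ tendsto_const])
    show "\<forall>\<^sub>F n in sequentially. 0 \<le> vacancy (Suc n)"
      by (simp add: vacancy_nonneg)
    show "\<forall>\<^sub>F n in sequentially. vacancy (Suc n) \<le> 1 / sqrt (Suc n)"
      by (intro always_eventually allI vacancy_le)
    have "filterlim (\<lambda>n. sqrt (Suc n)) at_top sequentially"
      by (rule filterlim_compose[OF sqrt_at_top filterlim_compose[OF filterlim_real_sequentially filterlim_Suc]])
    then show "(\<lambda>n. 1 / sqrt (Suc n)) \<longlonglongrightarrow> 0"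
      by (rule tendsto_divide_0[OF tendsto_const filterlim_at_top_imp_at_infinity])
  qed
  then show ?thesis by (rule LIMSEQ_imp_Suc)
qed

section \<open>Growth of the number of partial injections\<close>

text \<open>
  The coefficients of the exponential generating function of the number of partial injections.
\<close>

definition pinj_egf :: "nat \<Rightarrow> real" where
  "pinj_egf n = pinj_count n n / fact n"

lemma pinj_egf_pos: "pinj_egf n > 0"
  by (simp add: pinj_egf_def pinj_count_pos)

text \<open>
  This is why the vacancy probability controls the growth: it is the relative increment of
  \<open>pinj_egf\<close>.
\<close>

lemma pinj_egf_Suc: "pinj_egf n = (1 - vacancy (Suc n)) * pinj_egf (Suc n)"
proof -
  have "pinj_egf n = real (Suc n) * pinj_count n n / fact (Suc n)"
    by (simp add: pinj_egf_def)
  then show ?thesis unfolding vacancy_Suc_pred by (simp add: pinj_egf_def del: pinj_count.simps fact_Suc)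
qed

lemma pinj_egf_mono: "m \<le> n \<Longrightarrow> pinj_egf m \<le> pinj_egf n"
proof (rule lift_Suc_mono_le[of pinj_egf])
  fix n show "pinj_egf n \<le> pinj_egf (Suc n)"
    unfolding pinj_egf_Suc[of n] using vacancy_nonneg[of "Suc n"] pinj_egf_pos[of "Suc n"]
    by (intro mult_left_le_one_le) (auto intro: less_imp_le vacancy_less_1)
qed

lemma pinj_egf_shift: "(\<lambda>n. pinj_egf n / pinj_egf (n + k)) \<longlonglongrightarrow> 1"
proof (induction k)
  case 0
  show ?case using pinj_egf_pos by (simp add: less_imp_neq[symmetric])
next
  case (Suc k)
  have eq: "pinj_egf n / pinj_egf (n + Suc k) =
      pinj_egf n / pinj_egf (n + k) * (1 - vacancy (n + Suc k))" for n
  proof -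
    have pos: "pinj_egf (n + k) > 0" "pinj_egf (n + Suc k) > 0" by (rule pinj_egf_pos)+
    have "1 - vacancy (n + Suc k) = pinj_egf (n + k) / pinj_egf (n + Suc k)"
      using pos pinj_egf_Suc[of "n + k"] by (simp add: field_simps)
    then show ?thesis using pos by simp
  qed
  have "(\<lambda>n. vacancy (n + Suc k)) \<longlonglongrightarrow> 0"
    using vacancy_tendsto_0 by (rule LIMSEQ_ignore_initial_segment)
  with Suc have "(\<lambda>n. pinj_egf n / pinj_egf (n + k) * (1 - vacancy (n + Suc k))) \<longlonglongrightarrow> 1 * (1 - 0)"
    by (intro tendsto_intros)
  then show ?case unfolding eq by simp
qed

lemma pinj_egf_backshift: "(\<lambda>n. pinj_egf (n - k) / pinj_egf n) \<longlonglongrightarrow> 1"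
  by (rule LIMSEQ_offset[of _ k]) (use pinj_egf_shift[of k] in simp)

lemma pinj_count_binomial:
  assumes "k \<le> n"
  shows "real (n choose k) * pinj_count k k * pinj_count (n - k) (n - k) / pinj_count n n =
    pinj_egf k * pinj_egf (n - k) / pinj_egf n"
  using assms by (simp add: pinj_egf_def binomial_fact field_simps)

section \<open>Fixed points of a random partial injection\<close>

text \<open>
  Dominated convergence for series of sequences, with a bound valid for all indices.
\<close>

lemma tendsto_suminf_dominated:
  fixes t :: "nat \<Rightarrow> nat \<Rightarrow> real"
  assumes "\<And>k. (\<lambda>n. t k n) \<longlonglongrightarrow> b k" "\<And>k n. norm (t k n) \<le> M k" "summable M"
  shows "(\<lambda>n. \<Sum>k. t k n) \<longlonglongrightarrow> (\<Sum>k. b k)"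
  using tannerys_theorem[of t b sequentially M] assms
  by (simp add: always_eventually split_beta)

definition loop_free_injections :: "'v set \<Rightarrow> ('v \<times> 'v) set set" where
  "loop_free_injections V = {R \<in> partial_injections V V. \<forall>v. (v, v) \<notin> R}"

text \<open>
  Inclusion-exclusion over the set \<open>F\<close> of points required to be fixed: the alternating sum over all subsets of the
  actual fixed point set vanishes unless that set is empty.
\<close>

lemma card_loop_free_injections:
  assumes "finite V"
  shows "real (card (loop_free_injections V)) =
    (\<Sum>k\<le>card V. (- 1) ^ k * real (card V choose k) * real (pinj_count (card V - k) (card V - k)))"
proof -
  let ?P = "partial_injections V V"
  have fin: "finite ?P" using assms by (simp add: finite_partial_injections)
  \<comment> \<open>Expanding the product of \<open>1 + (- 1)\<close> over the fixed points of \<open>R\<close> gives the alternating sum.\<close>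
  have alt: "(\<Sum>F\<in>Pow V. if Id_on F \<subseteq> R then (- 1) ^ card F else 0) = (if \<forall>v. (v, v) \<notin> R then 1 else (0 :: real))"
    if "R \<in> ?P" for R
  proof -
    define S where "S = {v \<in> V. (v, v) \<in> R}"
    have S: "finite S" using assms by (simp add: S_def)
    have "(\<Sum>F\<in>Pow V. if Id_on F \<subseteq> R then (- 1) ^ card F else 0) = (\<Sum>F\<in>Pow S. (- 1 :: real) ^ card F)"
      using assms by (intro sum.mono_neutral_cong_right) (auto simp: S_def)
    also have "\<dots> = (\<Prod>v\<in>S. (- 1) + 1)"
      using prod_add[OF S, of "\<lambda>_. - 1" "\<lambda>_. 1 :: real"] by simp
    also have "\<dots> = (if S = {} then 1 else 0)"
      using S by (simp add: card_gt_0_iff power_0_left)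
    also have "S = {} \<longleftrightarrow> (\<forall>v. (v, v) \<notin> R)"
      using that by (auto simp: S_def partial_injections_def)
    finally show ?thesis .
  qed
  have ext: "card {R \<in> ?P. Id_on F \<subseteq> R} = pinj_count (card V - card F) (card V - card F)"
    if "F \<subseteq> V" for F
  proof -
    have "card {R \<in> partial_injections (F \<union> (V - F)) (F \<union> (V - F)). Id_on F \<subseteq> R} =
        card (partial_injections (V - F) (V - F))"
      by (intro card_partial_injections_extending)
        (auto simp: partial_injections_def single_valued_def)
    also have "\<dots> = pinj_count (card V - card F) (card V - card F)"
      using that assms by (simp add: card_partial_injections card_Diff_subset finite_subset)
    finally show ?thesis using that by (simp add: Un_absorb1)
  qed
  have "real (card (loop_free_injections V)) = (\<Sum>R\<in>?P. if \<forall>v. (v, v) \<notin> R then 1 else 0)"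
    using fin by (simp add: loop_free_injections_def sum.If_cases Int_def)
  also have "\<dots> = (\<Sum>R\<in>?P. \<Sum>F\<in>Pow V. if Id_on F \<subseteq> R then (- 1) ^ card F else 0)"
    by (intro sum.cong refl) (simp only: alt)
  also have "\<dots> = (\<Sum>F\<in>Pow V. \<Sum>R\<in>?P. if Id_on F \<subseteq> R then (- 1) ^ card F else 0)"
    by (rule sum.swap)
  also have "\<dots> = (\<Sum>F\<in>Pow V. (- 1) ^ card F * real (pinj_count (card V - card F) (card V - card F)))"
  proof (intro sum.cong refl)
    fix F assume "F \<in> Pow V"
    then show "(\<Sum>R\<in>?P. if Id_on F \<subseteq> R then (- 1) ^ card F else 0) =
        (- 1 :: real) ^ card F * pinj_count (card V - card F) (card V - card F)"
      using fin ext[of F] by (simp add: sum.If_cases Int_def)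
  qed
  also have "\<dots> = (\<Sum>k\<le>card V. \<Sum>F | F \<in> Pow V \<and> card F = k.
      (- 1) ^ card F * real (pinj_count (card V - card F) (card V - card F)))"
    using assms by (intro sum.group[symmetric]) (auto intro: card_mono)
  also have "\<dots> = (\<Sum>k\<le>card V. (- 1) ^ k * real (card V choose k) * real (pinj_count (card V - k) (card V - k)))"
  proof (intro sum.cong refl)
    fix k
    have "(\<Sum>F | F \<in> Pow V \<and> card F = k. (- 1) ^ card F * real (pinj_count (card V - card F) (card V - card F)))
        = (\<Sum>F | F \<in> Pow V \<and> card F = k. (- 1) ^ k * real (pinj_count (card V - k) (card V - k)))"
      by (intro sum.cong) auto
    also have "\<dots> = (- 1) ^ k * real (card V choose k) * real (pinj_count (card V - k) (card V - k))"
      using n_subsets[OF assms, of k] by simp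
    finally show "(\<Sum>F | F \<in> Pow V \<and> card F = k. (- 1) ^ card F * real (pinj_count (card V - card F) (card V - card F)))
       = (- 1) ^ k * real (card V choose k) * real (pinj_count (card V - k) (card V - k))" .
  qed
  finally show ?thesis .
qed

text \<open>
  After division by the number of all partial injections, the alternating sum becomes the exponential
  series at \<open>- 1\<close> with weights \<open>pinj_egf (n - k) / pinj_egf n\<close>.  They are at most \<open>1\<close> and tend to \<open>1\<close>,
  so the limit can be taken term by term.
\<close>

lemma loop_free_fraction:
  "(\<lambda>n. card (loop_free_injections {..<n}) / pinj_count n n) \<longlonglongrightarrow> exp (- 1)"
proof -
  define t :: "nat \<Rightarrow> nat \<Rightarrow> real"
    where "t k n = (if k \<le> n then (- 1) ^ k / fact k * (pinj_egf (n - k) / pinj_egf n) else 0)" for k n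
  have lim: "(\<lambda>n. t k n) \<longlonglongrightarrow> (- 1) ^ k / fact k" for k
  proof -
    have "(\<lambda>n. (- 1) ^ k / fact k * (pinj_egf (n - k) / pinj_egf n)) \<longlonglongrightarrow> (- 1) ^ k / fact k * 1"
      by (intro tendsto_intros pinj_egf_backshift)
    then have "(\<lambda>n. (- 1) ^ k / fact k * (pinj_egf (n - k) / pinj_egf n)) \<longlonglongrightarrow> (- 1) ^ k / fact k"
      by simp
    moreover have "\<forall>\<^sub>F n in sequentially. (- 1) ^ k / fact k * (pinj_egf (n - k) / pinj_egf n) = t k n"
      using eventually_ge_at_top[of k] by eventually_elim (simp add: t_def)
    ultimately show ?thesis by (rule Lim_transform_eventually)
  qed
  have bound: "norm (t k n) \<le> 1 / fact k" for k n
  proof -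
    have "pinj_egf (n - k) / pinj_egf n \<le> 1" "0 \<le> pinj_egf (n - k) / pinj_egf n"
      using pinj_egf_mono[of "n - k" n] pinj_egf_pos[of n] pinj_egf_pos[of "n - k"] by simp_all
    then have "1 / fact k * (pinj_egf (n - k) / pinj_egf n) \<le> 1 / fact k * 1"
      by (intro mult_left_mono) auto
    then show ?thesis
      using pinj_egf_pos[of n] pinj_egf_pos[of "n - k"] by (simp add: t_def abs_mult)
  qed
  have "summable (\<lambda>k. 1 / fact k :: real)"
    using summable_exp[of "1 :: real"] by (simp add: field_simps)
  then have "(\<lambda>n. \<Sum>k. t k n) \<longlonglongrightarrow> (\<Sum>k. (- 1) ^ k / fact k)"
    by (rule tendsto_suminf_dominated[OF lim bound])
  also have "(\<lambda>n. \<Sum>k. t k n) = (\<lambda>n. card (loop_free_injections {..<n}) / pinj_count n n)"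
  proof
    fix n
    have "(\<Sum>k. t k n) = (\<Sum>k\<le>n. t k n)"
      by (rule suminf_finite) (auto simp: t_def)
    also have "\<dots> = (\<Sum>k\<le>n. (- 1) ^ k * real (n choose k) * real (pinj_count (n - k) (n - k)) / pinj_count n n)"
      by (intro sum.cong refl)
        (auto simp: t_def pinj_egf_def binomial_fact field_simps)
    also have "\<dots> = card (loop_free_injections {..<n}) / pinj_count n n"
      by (simp add: card_loop_free_injections sum_divide_distrib)
    finally show "(\<Sum>k. t k n) = card (loop_free_injections {..<n}) / pinj_count n n" .
  qed
  also have "(\<Sum>k. (- 1) ^ k / fact k) = exp (- 1 :: real)"
    by (simp add: exp_def field_simps)
  finally show ?thesis .
qed

section \<open>Random graphs\<close>

definition slice :: "('v \<times> 'a \<times> 'v) set \<Rightarrow> 'a \<Rightarrow> ('v \<times> 'v) set" where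
  "slice E a = {(u, v). (u, a, v) \<in> E}"

lemma mem_slice [simp]: "(u, v) \<in> slice E a \<longleftrightarrow> (u, a, v) \<in> E"
  by (simp add: slice_def)

text \<open>
  The two determinism conditions say precisely that each letter acts as a partial injection.
\<close>

lemma is_graph_iff_slices:
  "is_graph A V E \<longleftrightarrow> E \<subseteq> V \<times> A \<times> V \<and> (\<forall>a\<in>A. slice E a \<in> partial_injections V V)"
proof
  assume "is_graph A V E"
  then have E: "E \<subseteq> V \<times> A \<times> V"
    and "\<forall>u a v v'. (u, a, v) \<in> E \<and> (u, a, v') \<in> E \<longrightarrow> v = v'"
    and "\<forall>u u' a v. (u, a, v) \<in> E \<and> (u', a, v) \<in> E \<longrightarrow> u = u'"
    unfolding is_graph_def by simp_all
  then have "single_valued (slice E a)" "single_valued ((slice E a)\<inverse>)" for a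
    unfolding single_valued_def converse_iff mem_slice by metis+
  moreover have "slice E a \<subseteq> V \<times> V" for a using E by (auto simp: slice_def)
  ultimately show "E \<subseteq> V \<times> A \<times> V \<and> (\<forall>a\<in>A. slice E a \<in> partial_injections V V)"
    using E unfolding partial_injections_def by simp
next
  assume r: "E \<subseteq> V \<times> A \<times> V \<and> (\<forall>a\<in>A. slice E a \<in> partial_injections V V)"
  have "single_valued (slice E a)" "single_valued ((slice E a)\<inverse>)" if "(u, a, v) \<in> E" for u a v
    using r that by (auto simp: partial_injections_def)
  then show "is_graph A V E"
    unfolding is_graph_def single_valued_def using r by (simp, metis)
qed

lemma finite_graphs: "finite A \<Longrightarrow> finite V \<Longrightarrow> finite {E. is_graph A V E \<and> P E}"
  by (rule finite_subset[of _ "Pow (V \<times> A \<times> V)"]) (auto simp: is_graph_def)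

text \<open>
  Letters are independent: a graph is an arbitrary choice of one partial injection per letter.
\<close>

lemma card_graphs_slices:
  assumes "finite A" "\<And>a. a \<in> A \<Longrightarrow> Q a \<subseteq> partial_injections V V"
  shows "card {E. is_graph A V E \<and> (\<forall>a\<in>A. slice E a \<in> Q a)} = (\<Prod>a\<in>A. card (Q a))"
proof -
  have Q: "f a \<subseteq> V \<times> V" if "f \<in> Pi\<^sub>E A Q" "a \<in> A" for f a
    using that assms(2) by (fastforce simp: partial_injections_def)
  have "bij_betw (\<lambda>E. restrict (slice E) A)
      {E. is_graph A V E \<and> (\<forall>a\<in>A. slice E a \<in> Q a)} (Pi\<^sub>E A Q)"
  proof (rule bij_betw_byWitness[where f' = "\<lambda>f. {(u, a, v). a \<in> A \<and> (u, v) \<in> f a}"])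
    show "(\<lambda>f. {(u, a, v). a \<in> A \<and> (u, v) \<in> f a}) ` Pi\<^sub>E A Q \<subseteq>
        {E. is_graph A V E \<and> (\<forall>a\<in>A. slice E a \<in> Q a)}"
    proof (rule image_subsetI)
      fix f assume f: "f \<in> Pi\<^sub>E A Q"
      let ?E = "{(u, a, v). a \<in> A \<and> (u, v) \<in> f a}"
      have "slice ?E a = f a" if "a \<in> A" for a using that by (auto simp: slice_def)
      moreover have "?E \<subseteq> V \<times> A \<times> V" using Q[OF f] by blast
      ultimately show "?E \<in> {E. is_graph A V E \<and> (\<forall>a\<in>A. slice E a \<in> Q a)}"
        using f assms(2) unfolding is_graph_iff_slices by (simp add: PiE_def Pi_def) blast
    qed
    show "\<forall>E\<in>{E. is_graph A V E \<and> (\<forall>a\<in>A. slice E a \<in> Q a)}.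
        {(u, a, v). a \<in> A \<and> (u, v) \<in> restrict (slice E) A a} = E"
      by (auto simp: is_graph_def)
    show "\<forall>f\<in>Pi\<^sub>E A Q. restrict (slice {(u, a, v). a \<in> A \<and> (u, v) \<in> f a}) A = f"
      by (auto simp: slice_def fun_eq_iff restrict_def PiE_def extensional_def)
  qed auto
  from bij_betw_same_card[OF this] show ?thesis
    using assms(1) by (simp add: card_PiE)
qed

text \<open>
  The probability that a uniformly random graph on \<open>{..<n}\<close>, not necessarily connected and possibly with
  leaves, has the property \<open>P\<close>.
\<close>

definition graph_fraction :: "'a set \<Rightarrow> nat \<Rightarrow> ((nat \<times> 'a \<times> nat) set \<Rightarrow> bool) \<Rightarrow> real" where
  "graph_fraction A n P = card {E. is_graph A {..<n} E \<and> P E} / pinj_count n n ^ card A"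

lemma graph_fraction_nonneg: "graph_fraction A n P \<ge> 0"
  by (simp add: graph_fraction_def)

lemma graph_fraction_mono:
  assumes "finite A" "\<And>E. is_graph A {..<n} E \<Longrightarrow> P E \<Longrightarrow> Q E"
  shows "graph_fraction A n P \<le> graph_fraction A n Q"
  unfolding graph_fraction_def using assms
  by (intro divide_right_mono of_nat_mono card_mono finite_graphs) auto

lemma graph_fraction_disj_le:
  assumes "finite A"
  shows "graph_fraction A n (\<lambda>E. P E \<or> Q E) \<le> graph_fraction A n P + graph_fraction A n Q"
proof -
  have "{E. is_graph A {..<n} E \<and> (P E \<or> Q E)} =
      {E. is_graph A {..<n} E \<and> P E} \<union> {E. is_graph A {..<n} E \<and> Q E}" by blast
  then have "card {E. is_graph A {..<n} E \<and> (P E \<or> Q E)} \<le>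
      card {E. is_graph A {..<n} E \<and> P E} + card {E. is_graph A {..<n} E \<and> Q E}"
    by (simp add: card_Un_le)
  then show ?thesis
    unfolding graph_fraction_def add_divide_distrib[symmetric] of_nat_add[symmetric]
    by (intro divide_right_mono of_nat_mono) auto
qed

lemma graph_fraction_Bex_le:
  assumes "finite A" "finite I"
  shows "graph_fraction A n (\<lambda>E. \<exists>i\<in>I. P i E) \<le> (\<Sum>i\<in>I. graph_fraction A n (P i))"
  using assms(2)
proof (induction I rule: finite_induct)
  case empty
  show ?case by (simp add: graph_fraction_def)
next
  case (insert i I)
  then show ?case
    using graph_fraction_disj_le[OF assms(1), of n "P i" "\<lambda>E. \<exists>i\<in>I. P i E"] by simp
qed

lemma graph_fraction_slices:
  assumes "finite A" "\<And>a. a \<in> A \<Longrightarrow> Q a \<subseteq> partial_injections {..<n} {..<n}"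
  shows "graph_fraction A n (\<lambda>E. \<forall>a\<in>A. slice E a \<in> Q a) = (\<Prod>a\<in>A. card (Q a) / pinj_count n n)"
  unfolding graph_fraction_def using card_graphs_slices[OF assms] by (simp add: prod_dividef)

lemma graph_fraction_split:
  assumes "finite A"
  shows "graph_fraction A n P + graph_fraction A n (\<lambda>E. \<not> P E) = 1"
proof -
  let ?G = "{E. is_graph A {..<n} E}" and ?P = "{E. is_graph A {..<n} E \<and> P E}"
    and ?N = "{E. is_graph A {..<n} E \<and> \<not> P E}"
  have "?G = {E. is_graph A {..<n} E \<and> (\<forall>a\<in>A. slice E a \<in> partial_injections {..<n} {..<n})}"
    by (auto simp: is_graph_iff_slices)
  then have "card ?G = pinj_count n n ^ card A"
    using card_graphs_slices[OF assms, of "\<lambda>_. partial_injections {..<n} {..<n}" "{..<n}"]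
    by (simp add: card_partial_injections)
  moreover have "card (?P \<union> ?N) = card ?P + card ?N"
    using assms by (intro card_Un_disjoint finite_graphs) auto
  moreover have "?P \<union> ?N = ?G" by blast
  ultimately have "real (card ?P) + real (card ?N) = pinj_count n n ^ card A"
    by (simp only: of_nat_add[symmetric] of_nat_power[symmetric])
  then show ?thesis
    using pinj_count_pos[of n n] unfolding graph_fraction_def add_divide_distrib[symmetric] by simp
qed

section \<open>Loops of a random graph\<close>

definition loop_free :: "('v \<times> 'a \<times> 'v) set \<Rightarrow> bool" where
  "loop_free E \<longleftrightarrow> (\<forall>v a. (v, a, v) \<notin> E)"

lemma loop_free_graph_fraction:
  assumes "finite A"
  shows "(\<lambda>n. graph_fraction A n loop_free) \<longlonglongrightarrow> exp (- real (card A))"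
proof -
  have "graph_fraction A n loop_free = (card (loop_free_injections {..<n}) / pinj_count n n) ^ card A" for n
  proof -
    have "{E. is_graph A {..<n} E \<and> loop_free E} =
        {E. is_graph A {..<n} E \<and> (\<forall>a\<in>A. slice E a \<in> loop_free_injections {..<n})}"
      unfolding is_graph_iff_slices loop_free_def loop_free_injections_def by auto
    then show ?thesis
      using graph_fraction_slices[OF assms, of "\<lambda>_. loop_free_injections {..<n}" n]
      by (auto simp: graph_fraction_def loop_free_injections_def)
  qed
  moreover have "(\<lambda>n. (card (loop_free_injections {..<n}) / pinj_count n n) ^ card A)
      \<longlonglongrightarrow> exp (- 1) ^ card A"
    by (intro tendsto_power loop_free_fraction)
  ultimately show ?thesis by (simp add: exp_of_nat_mult[symmetric])
qed

section \<open>Leaves of a random graph\<close>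

text \<open>
  At most one of the four ends of \<open>a\<close>- and \<open>b\<close>-edges at a leaf is present.  So one letter,
  called \<open>c\<close>, is absent on both sides, and the other letter \<open>d\<close> is absent on one side.
\<close>

lemma leaf_slices:
  assumes "is_leaf E v" "finite E" "a \<noteq> b"
  obtains c d where "(c, d) \<in> {(a, b), (b, a)}"
    "v \<notin> Domain (slice E c)" "v \<notin> Range (slice E c)"
    "v \<notin> Domain (slice E d) \<or> v \<notin> Range (slice E d)"
proof -
  define X where "X = {(x, a, y) \<in> E. x = v}"
  define Y where "Y = {(x, a, y) \<in> E. y = v}"
  have fin: "finite X" "finite Y"
    using assms(2) by (auto simp: X_def Y_def intro: finite_subset[of _ E])
  have le: "card X + card Y \<le> 1"
    using assms(1) by (simp add: is_leaf_def occurrences_def X_def Y_def)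
  have X: "s = t" if "s \<in> X" "t \<in> X" for s t
    using le fin that card_le_Suc0_iff_eq[of X] by auto
  have Y: "s = t" if "s \<in> Y" "t \<in> Y" for s t
    using le fin that card_le_Suc0_iff_eq[of Y] by auto
  have XY: "X = {} \<or> Y = {}"
  proof (rule ccontr)
    assume "\<not> ?thesis"
    then have "card X > 0" "card Y > 0" using fin by (auto simp: card_gt_0_iff)
    then show False using le by simp
  qed
  have dom: "\<exists>y. (v, c, y) \<in> X" if "v \<in> Domain (slice E c)" for c
    using that by (auto simp: X_def)
  have ran: "\<exists>x. (x, c, v) \<in> Y" if "v \<in> Range (slice E c)" for c
    using that by (auto simp: Y_def)
  have both: "v \<notin> Domain (slice E c) \<or> v \<notin> Range (slice E d)" for c d
    using dom[of c] ran[of d] XY by blast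
  have one: "v \<notin> Domain (slice E a) \<or> v \<notin> Domain (slice E b)"
    using dom[of a] dom[of b] X assms(3) by blast
  have two: "v \<notin> Range (slice E a) \<or> v \<notin> Range (slice E b)"
    using ran[of a] ran[of b] Y assms(3) by blast
  show ?thesis using one two both[of a b] both[of b a] both[of a a] both[of b b] that
    by blast
qed

text \<open>
  Independence of two letters, the other letters being unconstrained.
\<close>

lemma graph_fraction_two_slices:
  assumes "finite A" "a \<in> A" "b \<in> A" "a \<noteq> b"
    "U \<subseteq> partial_injections {..<n} {..<n}" "W \<subseteq> partial_injections {..<n} {..<n}"
  shows "graph_fraction A n (\<lambda>E. slice E a \<in> U \<and> slice E b \<in> W) =
    (card U / pinj_count n n) * (card W / pinj_count n n)"
proof -
  define Q where "Q c = (if c = a then U else if c = b then W else partial_injections {..<n} {..<n})" for c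
  have "{E. is_graph A {..<n} E \<and> (slice E a \<in> U \<and> slice E b \<in> W)} =
      {E. is_graph A {..<n} E \<and> (\<forall>c\<in>A. slice E c \<in> Q c)}"
    unfolding is_graph_iff_slices Q_def using assms by (auto split: if_splits)
  then have "graph_fraction A n (\<lambda>E. slice E a \<in> U \<and> slice E b \<in> W) =
      graph_fraction A n (\<lambda>E. \<forall>c\<in>A. slice E c \<in> Q c)"
    unfolding graph_fraction_def by (simp only:)
  also have "\<dots> = (\<Prod>c\<in>A. card (Q c) / pinj_count n n)"
    using assms by (intro graph_fraction_slices) (auto simp: Q_def)
  also have "\<dots> = (\<Prod>c\<in>{a, b}. card (Q c) / pinj_count n n)"
    using assms pinj_count_pos[of n n]
    by (intro prod.mono_neutral_right) (auto simp: Q_def card_partial_injections)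
  also have "\<dots> = (card U / pinj_count n n) * (card W / pinj_count n n)"
    using assms(4) by (simp add: Q_def)
  finally show ?thesis .
qed

text \<open>
  Union bound.  That a letter misses \<open>v\<close> on both sides has probability at most \<open>1 / n\<close>, that another letter
  misses it on a given side has probability \<open>vacancy n\<close>.  There are two orders of the letters and two
  sides, hence the bound \<open>4 * vacancy n / n\<close> for each of the \<open>n\<close> vertices.
\<close>

lemma leaf_graph_fraction:
  assumes "finite A" "2 \<le> card A"
  shows "(\<lambda>n. graph_fraction A n (\<lambda>E. \<exists>v\<in>{..<n}. is_leaf E v)) \<longlonglongrightarrow> 0"
proof -
  obtain a b where ab: "a \<in> A" "b \<in> A" "a \<noteq> b"
    using assms card_le_Suc0_iff_eq[of A] by auto
  have le: "graph_fraction A n (\<lambda>E. \<exists>v\<in>{..<n}. is_leaf E v) \<le> 4 * vacancy n" for n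
  proof -
    let ?P = "partial_injections {..<n} {..<n}"
    define U where "U v = {R \<in> ?P. v \<notin> Domain R \<and> v \<notin> Range R}" for v
    define W where "W k v = {R \<in> ?P. v \<notin> (if k then Domain R else Range R)}" for v and k :: bool
    have leaf: "graph_fraction A n (\<lambda>E. is_leaf E v) \<le> 4 * (vacancy n / n)" if v: "v < n" for v
    proof -
      have U: "card (U v) = pinj_count (n - 1) (n - 1)"
      proof -
        have "U v = partial_injections ({..<n} - {v}) ({..<n} - {v})"
          by (auto simp: U_def partial_injections_def)
        then show ?thesis using v by (simp add: card_partial_injections)
      qed
      have "card (W True v) = pinj_count (n - 1) n"
      proof -
        have "W True v = partial_injections ({..<n} - {v}) {..<n}"
          by (auto simp: W_def partial_injections_def)
        then show ?thesis using v by (simp add: card_partial_injections)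
      qed
      moreover have "card (W False v) = pinj_count n (n - 1)"
      proof -
        have "W False v = partial_injections {..<n} ({..<n} - {v})"
          by (auto simp: W_def partial_injections_def)
        then show ?thesis using v by (simp add: card_partial_injections)
      qed
      ultimately have W: "card (W k v) = pinj_count (n - 1) n" for k
        by (cases k) (simp_all only: pinj_count_swap[of n "n - 1"])
      have I: "real (pinj_count (n - 1) (n - 1)) / pinj_count n n \<le> 1 / n"
      proof -
        obtain m where n: "n = Suc m" using v by (cases n) auto
        have "real (Suc m) * pinj_count m m \<le> pinj_count (Suc m) (Suc m)"
          unfolding vacancy_Suc_pred
          using vacancy_nonneg[of "Suc m"] less_imp_le[OF vacancy_less_1[of m]]
          by (intro mult_left_le_one_le) auto
        then have "real n * pinj_count (n - 1) (n - 1) \<le> pinj_count n n" by (simp only: n diff_Suc_1)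
        then have "real n * (pinj_count (n - 1) (n - 1) / pinj_count n n) \<le> 1"
          using pinj_count_pos[of n n] by (auto simp only: times_divide_eq_right divide_le_eq_1 of_nat_0_less_iff)
        then show ?thesis using v by (simp add: pos_le_divide_eq mult.commute)
      qed
      have two: "graph_fraction A n (\<lambda>E. slice E c \<in> U v \<and> slice E d \<in> W k v) \<le> vacancy n / n"
        if "(c, d) \<in> {(a, b), (b, a)}" for c d k
      proof -
        have "graph_fraction A n (\<lambda>E. slice E c \<in> U v \<and> slice E d \<in> W k v) =
            (card (U v) / pinj_count n n) * (card (W k v) / pinj_count n n)"
          using that ab assms by (intro graph_fraction_two_slices) (auto simp: U_def W_def)
        also have "\<dots> \<le> (1 / n) * vacancy n"
          unfolding U W using I by (intro mult_mono) (auto simp: vacancy_def)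
        finally show ?thesis by simp
      qed
      define T where "T = {(a, b), (b, a)} \<times> (UNIV :: bool set)"
      define P where "P t E \<longleftrightarrow> slice E (fst (fst t)) \<in> U v \<and> slice E (snd (fst t)) \<in> W (snd t) v"
        for t and E :: "(nat \<times> 'a \<times> nat) set"
      have T: "finite T" "card T = 4" using ab(3) by (simp_all add: T_def card_cartesian_product)
      have "graph_fraction A n (\<lambda>E. is_leaf E v) \<le> graph_fraction A n (\<lambda>E. \<exists>t\<in>T. P t E)"
      proof (rule graph_fraction_mono[OF assms(1)])
        fix E assume E: "is_graph A {..<n} E" "is_leaf E v"
        then have "E \<subseteq> {..<n} \<times> A \<times> {..<n}" by (simp add: is_graph_def)
        then have fin: "finite E" by (rule finite_subset) (use assms in auto)
        obtain c d where cd: "(c, d) \<in> {(a, b), (b, a)}"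
          "v \<notin> Domain (slice E c)" "v \<notin> Range (slice E c)"
          "v \<notin> Domain (slice E d) \<or> v \<notin> Range (slice E d)"
          using leaf_slices[OF E(2) fin ab(3)] .
        have "slice E a \<in> ?P" "slice E b \<in> ?P"
          using E(1) ab(1,2) by (simp_all add: is_graph_iff_slices)
        then have sl: "slice E c \<in> ?P" "slice E d \<in> ?P" using cd(1) by auto
        have "((c, d), v \<notin> Domain (slice E d)) \<in> T"
          using cd(1) unfolding T_def by blast
        moreover have "P ((c, d), v \<notin> Domain (slice E d)) E"
          using cd(2-) sl unfolding P_def U_def W_def by simp
        ultimately show "\<exists>t\<in>T. P t E" by blast
      qed
      also have "\<dots> \<le> (\<Sum>t\<in>T. graph_fraction A n (P t))"
        by (rule graph_fraction_Bex_le[OF assms(1) T(1)])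
      also have "\<dots> \<le> (\<Sum>t\<in>T. vacancy n / n)"
        unfolding P_def by (intro sum_mono two) (auto simp: T_def)
      also have "\<dots> = 4 * (vacancy n / n)" using T by simp
      finally show ?thesis .
    qed
    have "graph_fraction A n (\<lambda>E. \<exists>v\<in>{..<n}. is_leaf E v) \<le>
        (\<Sum>v\<in>{..<n}. graph_fraction A n (\<lambda>E. is_leaf E v))"
      using assms(1) by (intro graph_fraction_Bex_le) auto
    also have "\<dots> \<le> (\<Sum>v\<in>{..<n}. 4 * (vacancy n / n))"
      by (intro sum_mono leaf) auto
    also have "\<dots> \<le> 4 * vacancy n" by (simp add: vacancy_nonneg)
    finally show ?thesis .
  qed
  have lim: "(\<lambda>n. 4 * vacancy n) \<longlonglongrightarrow> 0"
    using tendsto_mult[OF tendsto_const vacancy_tendsto_0, of 4] by simp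
  show ?thesis
  proof (rule tendsto_sandwich[OF _ _ tendsto_const lim])
    show "\<forall>\<^sub>F n in sequentially. 0 \<le> graph_fraction A n (\<lambda>E. \<exists>v\<in>{..<n}. is_leaf E v)"
      by (intro always_eventually allI graph_fraction_nonneg)
    show "\<forall>\<^sub>F n in sequentially. graph_fraction A n (\<lambda>E. \<exists>v\<in>{..<n}. is_leaf E v) \<le> 4 * vacancy n"
      by (intro always_eventually allI le)
  qed
qed

section \<open>Connectedness of a random graph\<close>

text \<open>
  Take a component or its complement, whichever is smaller.
\<close>

lemma not_connected_cut:
  assumes "is_graph A V E" "finite V" "\<not> is_connected V E"
  obtains S where "S \<subseteq> V" "S \<noteq> {}" "2 * card S \<le> card V"
    "\<forall>a. slice E a \<subseteq> S \<times> S \<union> (V - S) \<times> (V - S)"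
proof -
  obtain u v where uv: "u \<in> V" "v \<in> V" "(u, v) \<notin> (adjacency E)\<^sup>*"
    using assms(3) unfolding is_connected_def by blast
  define C where "C = {w \<in> V. (u, w) \<in> (adjacency E)\<^sup>*}"
  have E: "x \<in> V" "y \<in> V" if "(x, a, y) \<in> E" for x a y
    using assms(1) that by (auto simp: is_graph_def)
  have adj: "(x, y) \<in> adjacency E" "(y, x) \<in> adjacency E" if "(x, a, y) \<in> E" for x a y
    using that by (auto simp: adjacency_def)
  have "x \<in> C \<longleftrightarrow> y \<in> C" if "(x, a, y) \<in> E" for x a y
    using E[OF that] adj[OF that] unfolding C_def by (blast intro: rtrancl_into_rtrancl)
  then have cut: "slice E a \<subseteq> C \<times> C \<union> (V - C) \<times> (V - C)" for a
    using E by (auto simp: slice_def)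
  have C: "C \<subseteq> V" "u \<in> C" "v \<in> V - C" using uv by (auto simp: C_def)
  have card: "card C + card (V - C) = card V"
    using C(1) assms(2) by (metis card_Un_disjoint Diff_disjoint Diff_partition finite_Diff finite_subset)
  show ?thesis
  proof (cases "2 * card C \<le> card V")
    case True
    then show ?thesis using that[of C] C cut by auto
  next
    case False
    have "V - (V - C) = C" using C(1) by blast
    then have "slice E a \<subseteq> (V - C) \<times> (V - C) \<union> (V - (V - C)) \<times> (V - (V - C))" for a
      using cut[of a] by auto
    then show ?thesis using that[of "V - C"] C(3) False card by auto
  qed
qed

text \<open>
  For each letter, the block-diagonal partial injections have the same proportion \<open>x \<le> 1\<close> among all
  partial injections.  Independence gives \<open>x ^ card A\<close>, and two letters suffice for the bound.
\<close>

lemma cut_graph_fraction_le: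
  assumes "finite A" "2 \<le> card A" "S \<subseteq> {..<n}"
  shows "graph_fraction A n (\<lambda>E. \<forall>a. slice E a \<subseteq> S \<times> S \<union> ({..<n} - S) \<times> ({..<n} - S)) \<le>
    (pinj_egf (card S) * pinj_egf (n - card S) / pinj_egf n / (n choose card S))\<^sup>2"
proof -
  let ?P = "partial_injections {..<n} {..<n}" and ?k = "card S"
  define T where "T = {..<n} - S"
  define Q where "Q = {R \<in> ?P. R \<subseteq> S \<times> S \<union> T \<times> T}"
  define x where "x = card Q / pinj_count n n"
  have S: "finite S" "?k \<le> n" using assms(3) by (auto simp: finite_subset subset_eq_atLeast0_lessThan_card lessThan_atLeast0)
  have ST: "S \<union> T = {..<n}" "S \<inter> T = {}" using assms(3) by (auto simp: T_def)
  have T: "finite T" "card T = n - ?k" using assms(3) S(1) by (auto simp: T_def card_Diff_subset)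
  have cP: "card ?P = pinj_count n n" by (simp add: card_partial_injections)
  have "card Q = pinj_count ?k ?k * pinj_count (n - ?k) (n - ?k)"
    using card_partial_injections_split[OF ST(2) ST(2)] S(1) T unfolding ST(1) Q_def
    by (simp add: card_partial_injections)
  then have Cx: "real (n choose ?k) * x = pinj_egf ?k * pinj_egf (n - ?k) / pinj_egf n"
    using pinj_count_binomial[OF S(2)] by (simp add: x_def)
  have "x = real (n choose ?k) * x / (n choose ?k)" using S(2) by simp
  then have x: "x = pinj_egf ?k * pinj_egf (n - ?k) / pinj_egf n / (n choose ?k)"
    unfolding Cx .
  have "card Q \<le> card ?P" unfolding Q_def by (intro card_mono finite_partial_injections) auto
  then have x01: "0 \<le> x" "x \<le> 1" unfolding cP x_def using pinj_count_pos[of n n] by auto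
  have "graph_fraction A n (\<lambda>E. \<forall>a. slice E a \<subseteq> S \<times> S \<union> T \<times> T) \<le>
      graph_fraction A n (\<lambda>E. \<forall>a\<in>A. slice E a \<in> Q)"
    by (rule graph_fraction_mono[OF assms(1)]) (simp add: is_graph_iff_slices Q_def)
  also have "\<dots> = x ^ card A"
    using graph_fraction_slices[OF assms(1), of "\<lambda>_. Q" n] by (simp add: Q_def x_def)
  also have "\<dots> \<le> x ^ 2" using x01 assms(2) by (intro power_decreasing) auto
  finally show ?thesis unfolding x T_def .
qed

lemma binomial_ge_2_power:
  assumes "2 * k \<le> n"
  shows "2 ^ k \<le> real (n choose k)"
proof (cases "k = 0")
  case False
  have "(2 :: real) ^ k \<le> (real n / real k) ^ k"
    using assms False by (intro power_mono) (auto simp: field_simps)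
  also have "\<dots> \<le> real (n choose k)"
    using assms by (intro binomial_ge_n_over_k_pow_k) auto
  finally show ?thesis .
qed simp

text \<open>
  Union bound over all cuts.  A cut with \<open>k\<close> vertices on its smaller side costs at most
  \<open>(pinj_egf k / (n choose k))\<^sup>2\<close>, because \<open>pinj_egf\<close> is increasing, and there are \<open>n choose k\<close> such cuts.
  The \<open>k\<close>-th term tends to \<open>0\<close> and is dominated by \<open>(pinj_egf k)\<^sup>2 / 2 ^ k\<close>, whose ratios tend to
  \<open>1/2\<close>.
\<close>

lemma disconnected_graph_fraction:
  assumes "finite A" "2 \<le> card A"
  shows "(\<lambda>n. graph_fraction A n (\<lambda>E. \<not> is_connected {..<n} E)) \<longlonglongrightarrow> 0"
proof -
  define t :: "nat \<Rightarrow> nat \<Rightarrow> real"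
    where "t k n = (if 1 \<le> k \<and> 2 * k \<le> n then (pinj_egf k)\<^sup>2 / (n choose k) else 0)" for k n
  have le: "graph_fraction A n (\<lambda>E. \<not> is_connected {..<n} E) \<le> (\<Sum>k. t k n)" for n
  proof -
    define cut where "cut S E \<longleftrightarrow> (\<forall>a. slice E a \<subseteq> S \<times> S \<union> ({..<n} - S) \<times> ({..<n} - S))"
      for S and E :: "(nat \<times> 'a \<times> nat) set"
    define SS where "SS = {S. S \<subseteq> {..<n} \<and> S \<noteq> {} \<and> 2 * card S \<le> n}"
    have SS: "finite SS" by (rule finite_subset[of _ "Pow {..<n}"]) (auto simp: SS_def)
    have card_SS: "card S \<le> n" "card S \<noteq> 0" if "S \<in> SS" for S
      using that by (auto simp: SS_def finite_subset)
    have cut_le: "graph_fraction A n (cut S) \<le> t (card S) n / (n choose card S)" if "S \<in> SS" for S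
    proof -
      let ?k = "card S" and ?a = pinj_egf
      have sub: "S \<subseteq> {..<n}" using that by (simp add: SS_def)
      have "graph_fraction A n (cut S) \<le> (?a ?k * ?a (n - ?k) / ?a n / (n choose ?k))\<^sup>2"
        unfolding cut_def by (rule cut_graph_fraction_le[OF assms sub])
      also have "\<dots> \<le> (?a ?k / real (n choose ?k))\<^sup>2"
      proof (intro power_mono divide_right_mono)
        have "?a ?k * (?a (n - ?k) / ?a n) \<le> ?a ?k * 1"
          using pinj_egf_mono[of "n - ?k" n] pinj_egf_pos[of n] pinj_egf_pos[of ?k]
          by (intro mult_left_mono) auto
        then show "?a ?k * ?a (n - ?k) / ?a n \<le> ?a ?k" by simp
        show "0 \<le> ?a ?k * ?a (n - ?k) / ?a n / (n choose ?k)"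
          by (intro divide_nonneg_nonneg mult_nonneg_nonneg less_imp_le[OF pinj_egf_pos]) auto
      qed auto
      also have "\<dots> = t ?k n / (n choose ?k)"
      proof -
        have "1 \<le> ?k \<and> 2 * ?k \<le> n" using that card_SS(2)[OF that] by (simp add: SS_def)
        then show ?thesis by (simp add: t_def power2_eq_square)
      qed
      finally show ?thesis .
    qed
    have "graph_fraction A n (\<lambda>E. \<not> is_connected {..<n} E) \<le> graph_fraction A n (\<lambda>E. \<exists>S\<in>SS. cut S E)"
    proof (rule graph_fraction_mono[OF assms(1)])
      fix E assume "is_graph A {..<n} E" "\<not> is_connected {..<n} E"
      then obtain S where "S \<subseteq> {..<n}" "S \<noteq> {}" "2 * card S \<le> card {..<n}"
        "\<forall>a. slice E a \<subseteq> S \<times> S \<union> ({..<n} - S) \<times> ({..<n} - S)"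
        by (rule not_connected_cut[OF _ finite_lessThan])
      then show "\<exists>S\<in>SS. cut S E" unfolding SS_def cut_def by (intro bexI[of _ S]) simp_all
    qed
    also have "\<dots> \<le> (\<Sum>S\<in>SS. graph_fraction A n (cut S))"
      by (rule graph_fraction_Bex_le[OF assms(1) SS])
    also have "\<dots> \<le> (\<Sum>S\<in>SS. t (card S) n / (n choose card S))"
      by (intro sum_mono cut_le)
    also have "\<dots> = (\<Sum>k\<le>n. \<Sum>S | S \<in> SS \<and> card S = k. t (card S) n / (n choose card S))"
      using SS card_SS by (intro sum.group[symmetric]) auto
    also have "\<dots> \<le> (\<Sum>k\<le>n. t k n)"
    proof (intro sum_mono)
      fix k assume k: "k \<in> {..n}"
      let ?SS = "{S. S \<in> SS \<and> card S = k}"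
      have "(\<Sum>S\<in>?SS. t (card S) n / (n choose card S)) = (\<Sum>S\<in>?SS. t k n / (n choose k))"
        by (intro sum.cong) auto
      also have "\<dots> = card ?SS * (t k n / (n choose k))" by simp
      also have "\<dots> \<le> real (n choose k) * (t k n / (n choose k))"
      proof (intro mult_right_mono of_nat_mono)
        have "card ?SS \<le> card {S. S \<subseteq> {..<n} \<and> card S = k}"
          by (intro card_mono) (auto simp: SS_def)
        then show "card ?SS \<le> n choose k" by (simp add: n_subsets)
      qed (simp add: t_def)
      also have "\<dots> = t k n" using k by simp
      finally show "(\<Sum>S\<in>?SS. t (card S) n / (n choose card S)) \<le> t k n" .
    qed
    also have "\<dots> = (\<Sum>k. t k n)"
      by (rule suminf_finite[symmetric]) (auto simp: t_def)
    finally show ?thesis .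
  qed
  have lim: "(\<lambda>n. t k n) \<longlonglongrightarrow> 0" for k
  proof (cases "k = 0")
    case True
    then show ?thesis by (simp add: t_def)
  next
    case False
    have bound: "t k n \<le> (pinj_egf k)\<^sup>2 * (real k / real n)" for n
    proof (cases "2 * k \<le> n")
      case True
      have "real n / real k = (real n / real k) ^ 1" by simp
      also have "\<dots> \<le> (real n / real k) ^ k"
        using True False by (intro power_increasing) auto
      also have "\<dots> \<le> real (n choose k)" using True by (intro binomial_ge_n_over_k_pow_k) auto
      finally have "1 / real (n choose k) \<le> 1 / (real n / real k)"
        using True False by (intro divide_left_mono) auto
      then have "(pinj_egf k)\<^sup>2 * (1 / real (n choose k)) \<le> (pinj_egf k)\<^sup>2 * (real k / real n)"
        by (intro mult_left_mono) auto
      then show ?thesis using True False by (simp add: t_def)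
    qed (simp add: t_def)
    have "(\<lambda>n. (pinj_egf k)\<^sup>2 * (real k / real n)) \<longlonglongrightarrow> (pinj_egf k)\<^sup>2 * 0"
      by (intro tendsto_intros lim_const_over_n)
    then have limb: "(\<lambda>n. (pinj_egf k)\<^sup>2 * (real k / real n)) \<longlonglongrightarrow> 0" by simp
    show ?thesis
    proof (rule tendsto_sandwich[OF _ _ tendsto_const limb])
      show "\<forall>\<^sub>F n in sequentially. 0 \<le> t k n" by (simp add: t_def)
      show "\<forall>\<^sub>F n in sequentially. t k n \<le> (pinj_egf k)\<^sup>2 * (real k / real n)"
        by (intro always_eventually allI bound)
    qed
  qed
  define M where "M k = (pinj_egf k)\<^sup>2 / 2 ^ k" for k
  have bound: "norm (t k n) \<le> M k" for k n
    using binomial_ge_2_power[of k n] by (auto simp: t_def M_def intro!: divide_left_mono)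
  have "summable M"
  proof -
    have "(\<lambda>k. (pinj_egf k / pinj_egf (k + 1))\<^sup>2) \<longlonglongrightarrow> 1\<^sup>2"
      by (intro tendsto_power pinj_egf_shift)
    then have "\<forall>\<^sub>F k in sequentially. (2/3 :: real) < (pinj_egf k / pinj_egf (k + 1))\<^sup>2"
      by (rule order_tendstoD) simp
    \<comment> \<open>Any number strictly between \<open>1/2\<close> and \<open>1\<close> would do for the ratio of successive terms; once the squared
      quotient exceeds \<open>2/3\<close>, that ratio is at most \<open>3/4\<close>.\<close>
    then obtain N where N: "\<And>k. k \<ge> N \<Longrightarrow> 2/3 < (pinj_egf k / pinj_egf (k + 1))\<^sup>2"
      unfolding eventually_sequentially by blast
    show ?thesis
    proof (rule summable_ratio_test[of "3/4" N])
      fix k assume "N \<le> k"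
      then have "2/3 < (pinj_egf k)\<^sup>2 / (pinj_egf (Suc k))\<^sup>2" using N[of k] by (simp add: power_divide)
      then have "2/3 * (pinj_egf (Suc k))\<^sup>2 < (pinj_egf k)\<^sup>2"
        using pinj_egf_pos[of "Suc k"] by (simp add: field_simps)
      then show "norm (M (Suc k)) \<le> 3/4 * norm (M k)"
        by (simp add: M_def field_simps)
    qed simp
  qed
  from tendsto_suminf_dominated[OF lim bound this]
  have limS: "(\<lambda>n. \<Sum>k. t k n) \<longlonglongrightarrow> 0" by simp
  show ?thesis
  proof (rule tendsto_sandwich[OF _ _ tendsto_const limS])
    show "\<forall>\<^sub>F n in sequentially. 0 \<le> graph_fraction A n (\<lambda>E. \<not> is_connected {..<n} E)"
      by (intro always_eventually allI graph_fraction_nonneg)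
    show "\<forall>\<^sub>F n in sequentially. graph_fraction A n (\<lambda>E. \<not> is_connected {..<n} E) \<le> (\<Sum>k. t k n)"
      by (intro always_eventually allI le)
  qed
qed

section \<open>Words as paths\<close>

definition inv_word :: "'a word \<Rightarrow> 'a word" where
  "inv_word w = rev (map inv_letter w)"

text \<open>
  The triple that is traversed when the letter \<open>x\<close> is read from \<open>p\<close> to \<open>q\<close>.  It allows an inverse
  letter to be treated like a generator.
\<close>

definition edge :: "'v \<Rightarrow> 'a letter \<Rightarrow> 'v \<Rightarrow> 'v \<times> 'a \<times> 'v" where
  "edge p x q = (if snd x then (p, fst x, q) else (q, fst x, p))"

lemma edge_inv_letter: "edge p (inv_letter x) q = edge q x p"
  by (simp add: edge_def inv_letter_def)

lemma triple_eq_edge: "(u, a, v) = edge u (a, True) v"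
  by (simp add: edge_def)

lemma inv_letter_eq_iff: "inv_letter x = inv_letter y \<longleftrightarrow> x = y"
  by (metis inv_letter_inv_letter)

lemma reads_Cons: "reads E p (x # w) q \<longleftrightarrow> (\<exists>p'. edge p x p' \<in> E \<and> reads E p' w q)"
  by (cases x; cases "snd x") (auto simp: edge_def)

lemma reads_append: "reads E p (u @ w) q \<longleftrightarrow> (\<exists>p'. reads E p u p' \<and> reads E p' w q)"
  by (induction u arbitrary: p) (auto simp: reads_Cons simp del: reads.simps(2,3))

lemma reads_inv_word: "reads E p (inv_word w) q \<longleftrightarrow> reads E q w p"
  by (induction w arbitrary: q)
    (auto simp: inv_word_def reads_append reads_Cons edge_inv_letter simp del: reads.simps(2,3))

lemma edge_mem_graph:
  assumes "is_graph A V E" "edge p x q \<in> E"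
  shows "p \<in> V" "q \<in> V" "fst x \<in> A"
  using assms by (auto simp: is_graph_def edge_def split: if_splits)

lemma edge_unique:
  assumes "is_graph A V E" "edge p x q \<in> E" "edge p x q' \<in> E"
  shows "q = q'"
  using assms unfolding is_graph_def edge_def by (cases "snd x") (simp_all, blast+)

lemma reads_unique:
  assumes "is_graph A V E" "reads E p w q" "reads E p w q'"
  shows "q = q'"
  using assms(2,3)
proof (induction w arbitrary: p)
  case (Cons x w)
  then show ?case unfolding reads_Cons using edge_unique[OF assms(1)] by metis
qed simp

lemma reads_mem_graph:
  assumes "is_graph A V E" "p \<in> V" "reads E p w q"
  shows "q \<in> V" "fst ` set w \<subseteq> A"
proof -
  have "q \<in> V \<and> fst ` set w \<subseteq> A"
    using assms(2,3)
  proof (induction w arbitrary: p)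
    case (Cons x w)
    then obtain p' where "edge p x p' \<in> E" "reads E p' w q" unfolding reads_Cons by blast
    then show ?case using Cons.IH[of p'] edge_mem_graph[OF assms(1), of p x p'] by simp
  qed simp
  then show "q \<in> V" "fst ` set w \<subseteq> A" by simp_all
qed

text \<open>
  If \<open>x\<close> cancels against the first letter of \<open>w\<close>, then reading that letter retraces the edge just used,
  by determinism.
\<close>

lemma reads_cancel_cons:
  assumes "is_graph A V E" "edge p x p' \<in> E" "reads E p' w q"
  shows "reads E p (cancel_cons x w) q"
proof (cases w)
  case Nil
  then show ?thesis using assms(2,3) by (simp only: cancel_cons.simps reads_Cons) blast
next
  case (Cons y w')
  show ?thesis
  proof (cases "y = inv_letter x")
    case True
    obtain p'' where "edge p' y p'' \<in> E" "reads E p'' w' q"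
      using assms(3) unfolding Cons reads_Cons by blast
    moreover have "edge p' y p \<in> E" using assms(2) by (simp add: True edge_inv_letter)
    ultimately have "reads E p w' q" using edge_unique[OF assms(1)] by metis
    then show ?thesis by (simp add: Cons True)
  next
    case False
    then have "cancel_cons x w = x # w" by (simp add: Cons)
    then show ?thesis using assms(2,3) by (simp only: reads_Cons) blast
  qed
qed

text \<open>
  Free reduction does not change the end point of a path, so paths compose like group elements.
\<close>

lemma reads_word_mult:
  assumes "is_graph A V E" "reads E p u q" "reads E q w s"
  shows "reads E p (word_mult u w) s"
  using assms(2)
proof (induction u arbitrary: p)
  case Nil
  then show ?case using assms(3) by (simp add: word_mult_def)
next
  case (Cons x u)
  then obtain p' where "edge p x p' \<in> E" "reads E p' (word_mult u w) s"
    unfolding reads_Cons by blast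
  then have "reads E p (cancel_cons x (word_mult u w)) s"
    by (rule reads_cancel_cons[OF assms(1)])
  then show ?case by (simp add: word_mult_def)
qed

section \<open>Reduced words as group elements\<close>

lemma mem_free_group: "w \<in> carrier (free_group A) \<longleftrightarrow> reduced_word w \<and> fst ` set w \<subseteq> A"
  by (simp add: free_group_def)

lemma mult_free_group: "u \<otimes>\<^bsub>free_group A\<^esub> w = word_mult u w"
  by (simp add: free_group_def)

lemma one_free_group: "\<one>\<^bsub>free_group A\<^esub> = []"
  by (simp add: free_group_def)

lemma word_mult_append: "word_mult (u @ v) w = word_mult u (word_mult v w)"
  by (simp add: word_mult_def)

lemma word_mult_reduced: "reduced_word (u @ w) \<Longrightarrow> word_mult u w = u @ w"
proof (induction u)
  case (Cons x u)
  then have "word_mult u w = u @ w" using reduced_ConsD[of x "u @ w"] by simp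
  then show ?case using Cons.prems cancel_cons_reduced[of x "u @ w"] by (simp add: word_mult_def)
qed (simp add: word_mult_def)

lemma reduced_iff_successively: "reduced_word w \<longleftrightarrow> successively (\<lambda>x y. y \<noteq> inv_letter x) w"
  by (induction w rule: reduced_word.induct) auto

lemma reduced_append_iff:
  "reduced_word (u @ w) \<longleftrightarrow>
    reduced_word u \<and> reduced_word w \<and> (u = [] \<or> w = [] \<or> hd w \<noteq> inv_letter (last u))"
  by (auto simp: reduced_iff_successively successively_append_iff)

lemma reduced_inv_word: "reduced_word (inv_word w) \<longleftrightarrow> reduced_word w"
proof -
  have "successively (\<lambda>x y. inv_letter x \<noteq> y) w \<longleftrightarrow> successively (\<lambda>x y. y \<noteq> inv_letter x) w"
    by (rule successively_cong) auto
  then show ?thesis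
    by (simp add: reduced_iff_successively inv_word_def successively_map)
qed

lemma inv_word_mem: "w \<in> carrier (free_group A) \<Longrightarrow> inv_word w \<in> carrier (free_group A)"
  unfolding mem_free_group reduced_inv_word by (auto simp: inv_word_def)

lemma word_mult_inv_word: "word_mult (inv_word w) w = []"
proof (induction w)
  case (Cons x w)
  have "word_mult (inv_word (x # w)) (x # w) = word_mult (inv_word w) (word_mult [inv_letter x] (x # w))"
    by (simp add: inv_word_def word_mult_append)
  also have "word_mult [inv_letter x] (x # w) = w" by (simp add: word_mult_def)
  finally show ?case using Cons by simp
qed (simp add: inv_word_def word_mult_def)

lemma inv_free_group:
  assumes "w \<in> carrier (free_group A)"
  shows "inv\<^bsub>free_group A\<^esub> w = inv_word w"
  using assms inv_word_mem[OF assms] word_mult_inv_word[of w]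
  by (intro group.inv_equality[OF group_free_group]) (simp_all add: mult_free_group one_free_group)

lemma reads_inv_free_group:
  "w \<in> carrier (free_group A) \<Longrightarrow> reads E p (inv\<^bsub>free_group A\<^esub> w) q \<longleftrightarrow> reads E q w p"
  by (simp add: inv_free_group reads_inv_word)

lemma letter_mem: "fst x \<in> A \<Longrightarrow> [x] \<in> carrier (free_group A)"
  by (simp add: mem_free_group)

lemma inv_letter_free_group:
  "fst x \<in> A \<Longrightarrow> inv\<^bsub>free_group A\<^esub> [x] = [inv_letter x]"
  by (simp add: inv_free_group letter_mem inv_word_def)

lemma reads_mult:
  "is_graph A V E \<Longrightarrow> reads E p u q \<Longrightarrow> reads E q w s \<Longrightarrow> reads E p (u \<otimes>\<^bsub>free_group B\<^esub> w) s"
  unfolding mult_free_group by (rule reads_word_mult)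

lemma Cons_eq_mult: "reduced_word (x # w) \<Longrightarrow> x # w = [x] \<otimes>\<^bsub>free_group A\<^esub> w"
  unfolding mult_free_group using word_mult_reduced[of "[x]" w] by simp

lemma connected_reads:
  assumes "is_graph A V E" "is_connected V E" "p \<in> V" "q \<in> V"
  obtains w where "w \<in> carrier (free_group A)" "reads E p w q"
proof -
  interpret group "free_group A" by (rule group_free_group)
  have "(p, q) \<in> (adjacency E)\<^sup>*" using assms unfolding is_connected_def by blast
  then have "\<exists>w\<in>carrier (free_group A). reads E p w q"
  proof (induction rule: rtrancl_induct)
    case base
    show ?case using one_closed unfolding one_free_group by force
  next
    case (step y z)
    then obtain w where w: "w \<in> carrier (free_group A)" "reads E p w y" by blast
    obtain x where x: "edge y x z \<in> E"
      using step(2) unfolding adjacency_def edge_def by (auto; force)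
    then have "reads E y [x] z" by (simp add: reads_Cons del: reads.simps(2,3)) 
    then have "reads E p (w \<otimes>\<^bsub>free_group A\<^esub> [x]) z"
      using reads_mult[OF assms(1) w(2)] by blast
    moreover have "w \<otimes>\<^bsub>free_group A\<^esub> [x] \<in> carrier (free_group A)"
      using w(1) letter_mem edge_mem_graph(3)[OF assms(1) x] by blast
    ultimately show ?case by blast
  qed
  then show ?thesis using that by blast
qed

lemma reads_imp_rtrancl: "reads E p w q \<Longrightarrow> (p, q) \<in> (adjacency E)\<^sup>*"
proof (induction w arbitrary: p)
  case (Cons x w)
  then obtain p' where p': "edge p x p' \<in> E" "(p', q) \<in> (adjacency E)\<^sup>*" unfolding reads_Cons by blast
  then have "(p, p') \<in> adjacency E"
    by (auto simp: adjacency_def edge_def split: if_splits)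
  then show ?case using p'(2) by (rule converse_rtrancl_into_rtrancl)
qed simp

lemma connectedI:
  assumes "\<And>v. v \<in> V \<Longrightarrow> \<exists>w. reads E p w v"
  shows "is_connected V E"
  unfolding is_connected_def
proof (intro ballI)
  fix u v assume "u \<in> V" "v \<in> V"
  then obtain x y where "reads E p x u" "reads E p y v" using assms by blast
  then have "reads E u (inv_word x @ y) v" unfolding reads_append reads_inv_word by blast
  then show "(u, v) \<in> (adjacency E)\<^sup>*" by (rule reads_imp_rtrancl)
qed

section \<open>The subgroup of a graph\<close>

definition loop_subgroup :: "'a set \<Rightarrow> ('v \<times> 'a \<times> 'v) set \<Rightarrow> 'v \<Rightarrow> 'a word set" where
  "loop_subgroup A E p = {u \<in> carrier (free_group A). reads E p u p}"

lemma subgroup_loop_subgroup: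
  assumes "is_graph A V E"
  shows "subgroup (loop_subgroup A E p) (free_group A)"
proof -
  interpret group "free_group A" by (rule group_free_group)
  show ?thesis
  proof (rule subgroupI)
    have "[] \<in> loop_subgroup A E p" by (simp add: loop_subgroup_def mem_free_group)
    then show "loop_subgroup A E p \<noteq> {}" by blast
    fix u w assume u: "u \<in> loop_subgroup A E p" and w: "w \<in> loop_subgroup A E p"
    show "u \<otimes>\<^bsub>free_group A\<^esub> w \<in> loop_subgroup A E p"
      using u w reads_mult[OF assms, of p u p w p] by (simp add: loop_subgroup_def)
  next
    fix u assume u: "u \<in> loop_subgroup A E p"
    then show "inv\<^bsub>free_group A\<^esub> u \<in> loop_subgroup A E p"
      by (simp add: loop_subgroup_def reads_inv_free_group)
  qed (auto simp: loop_subgroup_def)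
qed

lemma is_stallings_graph_iff:
  assumes "H \<subseteq> carrier (free_group A)"
  shows "is_stallings_graph A H V E p \<longleftrightarrow> admissible A V E p \<and> H = loop_subgroup A E p"
  using assms unfolding is_stallings_graph_def loop_subgroup_def by blast

text \<open>
  For each vertex \<open>v\<close> fix a word \<open>W v\<close> from the root to \<open>v\<close>.  The loops \<open>W u a (W v)\<^sup>-\<^sup>1\<close>, one for each edge
  \<open>(u, a, v)\<close>, generate, since a loop \<open>x\<^sub>1 x\<^sub>2 \<dots>\<close> at the root becomes a product of such loops and their
  inverses when \<open>(W v)\<^sup>-\<^sup>1 W v\<close> is inserted at each vertex \<open>v\<close> on its way.
\<close>

lemma loop_subgroup_finitely_generated:
  assumes "is_graph A V E" "finite E" "is_connected V E" "p \<in> V"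
  shows "finitely_generated_subgroup A (loop_subgroup A E p)"
proof -
  interpret group "free_group A" by (rule group_free_group)
  let ?G = "free_group A"
  have "\<exists>w. w \<in> carrier ?G \<and> reads E p w v \<and> (v = p \<longrightarrow> w = [])" if "v \<in> V" for v
  proof (cases "v = p")
    case True
    then show ?thesis by (intro exI[of _ "[]"]) (simp add: mem_free_group)
  next
    case False
    then show ?thesis using connected_reads[OF assms(1,3,4) that] by metis
  qed
  then obtain W where W: "\<And>v. v \<in> V \<Longrightarrow> W v \<in> carrier ?G" "\<And>v. v \<in> V \<Longrightarrow> reads E p (W v) v" "W p = []"
    using assms(4) by metis
  define g where "g = (\<lambda>(u, a, v). W u \<otimes>\<^bsub>?G\<^esub> [(a, True)] \<otimes>\<^bsub>?G\<^esub> inv\<^bsub>?G\<^esub> W v)"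
  have E: "u \<in> V" "a \<in> A" "v \<in> V" if "(u, a, v) \<in> E" for u a v
    using assms(1) that by (auto simp: is_graph_def)
  have gE: "g ` E \<subseteq> loop_subgroup A E p"
  proof
    fix h assume "h \<in> g ` E"
    then obtain u a v where e: "(u, a, v) \<in> E" and h: "h = W u \<otimes>\<^bsub>?G\<^esub> [(a, True)] \<otimes>\<^bsub>?G\<^esub> inv\<^bsub>?G\<^esub> W v"
      by (auto simp: g_def)
    have "reads E u [(a, True)] v" using e by simp
    moreover have "reads E v (inv\<^bsub>?G\<^esub> W v) p" using W E[OF e] by (simp add: reads_inv_free_group)
    ultimately have "reads E p h p" unfolding h
      by (intro reads_mult[OF assms(1)]) (use W E[OF e] in blast)+
    moreover have "h \<in> carrier ?G" unfolding h using W E[OF e] letter_mem[of "(a, True)" A] by simp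
    ultimately show "h \<in> loop_subgroup A E p" by (simp add: loop_subgroup_def)
  qed
  have carr: "g ` E \<subseteq> carrier ?G" using gE by (auto simp: loop_subgroup_def)
  have step: "W u \<otimes>\<^bsub>?G\<^esub> [x] \<otimes>\<^bsub>?G\<^esub> inv\<^bsub>?G\<^esub> W v \<in> generate ?G (g ` E)" if e: "edge u x v \<in> E" for u x v
  proof (cases "snd x")
    case True
    then have "edge u x v = (u, fst x, v)" "x = (fst x, True)" by (simp_all add: edge_def prod_eq_iff)
    then have "W u \<otimes>\<^bsub>?G\<^esub> [x] \<otimes>\<^bsub>?G\<^esub> inv\<^bsub>?G\<^esub> W v \<in> g ` E"
      using e by (force simp: g_def)
    then show ?thesis by (rule generate.incl)
  next
    case False
    let ?h = "W v \<otimes>\<^bsub>?G\<^esub> [inv_letter x] \<otimes>\<^bsub>?G\<^esub> inv\<^bsub>?G\<^esub> W u"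
    have A: "u \<in> V" "v \<in> V" "fst x \<in> A" using edge_mem_graph[OF assms(1) e] by auto
    have "edge u x v = (v, fst x, u)" "inv_letter x = (fst x, True)"
      using False by (simp_all add: edge_def inv_letter_def)
    then have "?h \<in> g ` E" using e by (force simp: g_def)
    then have "inv\<^bsub>?G\<^esub> ?h \<in> generate ?G (g ` E)" by (rule generate.inv)
    also have "inv\<^bsub>?G\<^esub> ?h = W u \<otimes>\<^bsub>?G\<^esub> [x] \<otimes>\<^bsub>?G\<^esub> inv\<^bsub>?G\<^esub> W v"
      using W A letter_mem[of x A] by (simp add: inv_letter_free_group[symmetric] inv_mult_group m_assoc)
    finally show ?thesis .
  qed
  have path: "W u \<otimes>\<^bsub>?G\<^esub> w \<otimes>\<^bsub>?G\<^esub> inv\<^bsub>?G\<^esub> W v \<in> generate ?G (g ` E)"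
    if "u \<in> V" "w \<in> carrier ?G" "reads E u w v" for u v w
    using that
  proof (induction w arbitrary: u)
    case Nil
    then have "u = v" by simp
    moreover have "W v \<otimes>\<^bsub>?G\<^esub> [] \<otimes>\<^bsub>?G\<^esub> inv\<^bsub>?G\<^esub> W v = \<one>\<^bsub>?G\<^esub>" if "v \<in> V"
      using W(1)[OF that] by (simp flip: one_free_group[of A])
    ultimately show ?case using Nil.prems(1) by (simp add: generate.one)
  next
    case (Cons x w)
    obtain u' where u': "edge u x u' \<in> E" "reads E u' w v" using Cons.prems(3) unfolding reads_Cons by blast
    have A: "u' \<in> V" "fst x \<in> A" using edge_mem_graph[OF assms(1) u'(1)] by auto
    have v: "v \<in> V" using reads_mem_graph(1)[OF assms(1) A(1) u'(2)] .
    have w: "w \<in> carrier ?G" using Cons.prems(2) reduced_ConsD[of x w] by (simp add: mem_free_group)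
    note mem = W(1)[OF Cons.prems(1)] W(1)[OF A(1)] W(1)[OF v] w letter_mem[of x A, OF A(2)]
    have "x # w = [x] \<otimes>\<^bsub>?G\<^esub> w" using Cons.prems(2) by (intro Cons_eq_mult) (simp add: mem_free_group)
    moreover have "inv\<^bsub>?G\<^esub> W u' \<otimes>\<^bsub>?G\<^esub> (W u' \<otimes>\<^bsub>?G\<^esub> (w \<otimes>\<^bsub>?G\<^esub> inv\<^bsub>?G\<^esub> W v)) = w \<otimes>\<^bsub>?G\<^esub> inv\<^bsub>?G\<^esub> W v"
      using mem by (simp add: m_assoc[symmetric])
    ultimately have "W u \<otimes>\<^bsub>?G\<^esub> (x # w) \<otimes>\<^bsub>?G\<^esub> inv\<^bsub>?G\<^esub> W v =
        (W u \<otimes>\<^bsub>?G\<^esub> [x] \<otimes>\<^bsub>?G\<^esub> inv\<^bsub>?G\<^esub> W u') \<otimes>\<^bsub>?G\<^esub> (W u' \<otimes>\<^bsub>?G\<^esub> w \<otimes>\<^bsub>?G\<^esub> inv\<^bsub>?G\<^esub> W v)"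
      using mem by (simp add: m_assoc)
    then show ?case using step[OF u'(1)] Cons.IH[OF A(1) w u'(2)] by (simp add: generate.eng)
  qed
  have "loop_subgroup A E p \<subseteq> generate ?G (g ` E)"
  proof
    fix w assume "w \<in> loop_subgroup A E p"
    then have w: "w \<in> carrier ?G" "reads E p w p" by (auto simp: loop_subgroup_def)
    then show "w \<in> generate ?G (g ` E)"
      using path[OF assms(4) w] W(3) by (simp flip: one_free_group[of A])
  qed
  moreover have "generate ?G (g ` E) \<subseteq> loop_subgroup A E p"
    by (rule generate_subgroup_incl[OF gE subgroup_loop_subgroup[OF assms(1)]])
  ultimately show ?thesis
    unfolding finitely_generated_subgroup_def
    using subgroup_loop_subgroup[OF assms(1), of p] assms(2) carr by blast
qed

section \<open>Leaves and incident letters\<close>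

definition letters_at :: "('v \<times> 'a \<times> 'v) set \<Rightarrow> 'v \<Rightarrow> 'a letter set" where
  "letters_at E v = {x. \<exists>u. edge v x u \<in> E}"

text \<open>
  By determinism an incident letter leads along only one edge, so outgoing triples correspond to letters \<open>(a, True)\<close>
  and incoming ones to letters \<open>(a, False)\<close>; an \<open>a\<close>-loop accounts for both.
\<close>

lemma occurrences_eq_card_letters:
  fixes E :: "('v \<times> 'a \<times> 'v) set"
  assumes "is_graph A V E" "finite E"
  shows "finite (letters_at E v)" "occurrences E v = card (letters_at E v)"
proof -
  define X where "X = {(x, a, y) \<in> E. x = v}"
  define Y where "Y = {(x, a, y) \<in> E. y = v}"
  have fin: "finite X" "finite Y" using assms(2) by (auto simp: X_def Y_def intro: finite_subset[of _ E])
  define I where "I = (\<lambda>(x, a, y). (a, True)) ` X"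
  define J where "J = (\<lambda>(x, a, y). (a, False)) ` Y"
  have eq: "letters_at E v = I \<union> J"
  proof (rule Set.set_eqI)
    fix x :: "'a letter"
    show "x \<in> letters_at E v \<longleftrightarrow> x \<in> I \<union> J"
      by (cases x; cases "snd x") (force simp: letters_at_def edge_def I_def J_def X_def Y_def)+
  qed
  have out: "y = y'" if "(v, a, y) \<in> E" "(v, a, y') \<in> E" for a y y'
    using edge_unique[OF assms(1), of v "(a, True)" y y'] that by (simp add: edge_def)
  have into: "x = x'" if "(x, a, v) \<in> E" "(x', a, v) \<in> E" for a x x'
    using edge_unique[OF assms(1), of v "(a, False)" x x'] that by (simp add: edge_def)
  have IJ: "finite I" "finite J" "I \<inter> J = {}" using fin by (auto simp: I_def J_def)
  then show "finite (letters_at E v)" by (simp add: eq)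
  have "card I = card X" unfolding I_def
    using out by (intro card_image) (auto simp: inj_on_def X_def)
  moreover have "card J = card Y" unfolding J_def
    using into by (intro card_image) (auto simp: inj_on_def Y_def)
  moreover have "card (letters_at E v) = card I + card J"
    unfolding eq using IJ by (rule card_Un_disjoint)
  ultimately show "occurrences E v = card (letters_at E v)"
    by (simp add: occurrences_def X_def Y_def)
qed

lemma is_leaf_iff:
  assumes "is_graph A V E" "finite E"
  shows "is_leaf E v \<longleftrightarrow> (\<forall>x\<in>letters_at E v. \<forall>y\<in>letters_at E v. x = y)"
  using occurrences_eq_card_letters[OF assms, of v] card_le_Suc0_iff_eq[of "letters_at E v"]
  by (simp add: is_leaf_def)

lemma finite_graph_edges:
  assumes "is_graph A V E" "finite A" "finite V"
  shows "finite E"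
  using assms by (intro finite_subset[of E "V \<times> A \<times> V"]) (auto simp: is_graph_def)

section \<open>Reduced loops through a given edge\<close>

text \<open>
  No vertex is visited twice.  Since words do not record the visited vertices, this is expressed by the
  prefixes of \<open>w\<close>.
\<close>

definition simple_path :: "('v \<times> 'a \<times> 'v) set \<Rightarrow> 'v \<Rightarrow> 'a word \<Rightarrow> 'v \<Rightarrow> bool" where
  "simple_path E p w q \<longleftrightarrow> reads E p w q \<and>
    (\<forall>i j v. i \<le> length w \<longrightarrow> j \<le> length w \<longrightarrow>
      reads E p (take i w) v \<longrightarrow> reads E p (take j w) v \<longrightarrow> i = j)"

lemma simple_pathD:
  assumes "simple_path E p w q" "i \<le> length w" "j \<le> length w"
    "reads E p (take i w) v" "reads E p (take j w) v"
  shows "i = j"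
  using assms unfolding simple_path_def by blast

lemma reads_take:
  assumes "reads E p w q"
  obtains v where "reads E p (take i w) v" "reads E v (drop i w) q"
  using assms reads_append[of E p "take i w" "drop i w" q] by auto

lemma reads_nth:
  assumes "reads E p w q" "i < length w"
  obtains u v where "reads E p (take i w) u" "edge u (w ! i) v \<in> E"
    "reads E p (take (Suc i) w) v" "reads E v (drop (Suc i) w) q"
proof -
  obtain u where u: "reads E p (take i w) u" "reads E u (drop i w) q"
    using reads_take[OF assms(1)] .
  then obtain v where v: "edge u (w ! i) v \<in> E" "reads E v (drop (Suc i) w) q"
    unfolding Cons_nth_drop_Suc[OF assms(2), symmetric] reads_Cons by blast
  have "reads E p (take i w @ [w ! i]) v"
    unfolding reads_append reads_Cons using u v by auto
  then show ?thesis using that u v assms(2) by (simp add: take_Suc_conv_app_nth)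
qed

text \<open>
  Two consecutive mutually inverse letters would return to the vertex before the previous one.
\<close>

lemma simple_path_reduced:
  assumes "is_graph A V E" "simple_path E p w q"
  shows "reduced_word w"
  unfolding reduced_iff_successively successively_conv_nth
proof (intro allI impI notI)
  fix i assume i: "Suc i < length w" and eq: "w ! Suc i = inv_letter (w ! i)"
  have r: "reads E p w q" using assms(2) by (simp add: simple_path_def)
  obtain u v where u: "reads E p (take i w) u" "edge u (w ! i) v \<in> E" "reads E p (take (Suc i) w) v"
    using reads_nth[OF r Suc_lessD[OF i]] .
  obtain v' t where t: "reads E p (take (Suc i) w) v'" "edge v' (w ! Suc i) t \<in> E"
      "reads E p (take (Suc (Suc i)) w) t"
    using reads_nth[OF r i] .
  have "v' = v" using reads_unique[OF assms(1) t(1) u(3)] .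
  then have "t = u" using t(2) u(2) edge_unique[OF assms(1)] unfolding eq by (metis edge_inv_letter)
  then have "i = Suc (Suc i)"
    using simple_pathD[OF assms(2), of i "Suc (Suc i)" u] u(1) t(3) i by simp
  then show False by simp
qed

lemma simple_path_length:
  assumes "is_graph A V E" "finite V" "p \<in> V" "simple_path E p w q"
  shows "length w < card V"
proof -
  have r: "reads E p w q" using assms(4) by (simp add: simple_path_def)
  have "\<exists>v. reads E p (take i w) v" for i using reads_take[OF r] by metis
  then obtain f where f: "\<And>i. reads E p (take i w) (f i)" by metis
  have "inj_on f {..length w}"
  proof (rule inj_onI)
    fix i j assume "i \<in> {..length w}" "j \<in> {..length w}" "f i = f j"
    then show "i = j" using simple_pathD[OF assms(4), of i j "f i"] f[of i] f[of j] by simp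
  qed
  moreover have "f ` {..length w} \<subseteq> V" using reads_mem_graph(1)[OF assms(1,3) f] by blast
  ultimately have "card {..length w} \<le> card V" using assms(2) by (rule card_inj_on_le)
  then show ?thesis by simp
qed

text \<open>
  A shortest path is simple, as otherwise the part between two visits could be cut out.
\<close>

lemma simple_path_exists:
  assumes "is_graph A V E" "is_connected V E" "p \<in> V" "q \<in> V"
  obtains w where "simple_path E p w q"
proof -
  obtain w0 where "reads E p w0 q" using connected_reads[OF assms] by blast
  then obtain w where w: "reads E p w q" and min: "\<And>u. reads E p u q \<Longrightarrow> length w \<le> length u"
    using ex_has_least_nat[of "\<lambda>w. reads E p w q" w0 length] by blast
  have less: "\<not> i < j" if ij: "i \<le> length w" "j \<le> length w"
    and v: "reads E p (take i w) v" "reads E p (take j w) v" for i j v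
  proof
    assume "i < j"
    obtain v' where v': "reads E p (take j w) v'" "reads E v' (drop j w) q" using reads_take[OF w] .
    then have "v' = v" using reads_unique[OF assms(1)] v(2) by metis
    then have "reads E p (take i w @ drop j w) q" using v(1) v'(2) by (auto simp: reads_append)
    then show False using min[of "take i w @ drop j w"] \<open>i < j\<close> ij by simp
  qed
  have "simple_path E p w q"
    unfolding simple_path_def using w less by (meson linorder_neqE_nat)
  then show ?thesis by (rule that)
qed

text \<open>
  Follow \<open>w\<close>, then \<open>y\<close>, and go on without backtracking as long as new vertices appear; vertices other than the root
  are not leaves, so this never gets stuck.  In a finite graph the path eventually hits a vertex already visited,
  and from there it can return to the root along the inverse of its own initial segment.
\<close>

lemma simple_path_extends_to_loop:
  assumes adm: "admissible A V E p" and fin: "finite A"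
    and w: "simple_path E p w q" and y: "edge q y t \<in> E" "w = [] \<or> y \<noteq> inv_letter (last w)"
  shows "\<exists>z. reduced_word (w @ y # z) \<and> reads E p (w @ y # z) p"
  using w y
proof (induction "card V - length w" arbitrary: w q y t rule: less_induct)
  case less
  have g: "is_graph A V E" "finite V" "p \<in> V" using adm by (auto simp: admissible_def)
  have finE: "finite E" using finite_graph_edges[OF g(1) fin g(2)] .
  have r: "reads E p w q" using less.prems(1) by (simp add: simple_path_def)
  have red: "reduced_word w" using simple_path_reduced[OF g(1) less.prems(1)] .
  have red_y: "reduced_word (w @ [y])"
    using red less.prems(3) by (auto simp: reduced_append_iff)
  have r_y: "reads E p (w @ [y]) t"
    unfolding reads_append reads_Cons using r less.prems(2) by auto
  show ?case
  proof (cases "\<exists>i\<le>length w. reads E p (take i w) t")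
    case True
    then obtain i where i: "i \<le> length w" "reads E p (take i w) t" by blast
    let ?z = "inv_word (take i w)"
    have "reads E p ((w @ [y]) @ ?z) p"
      using r_y i(2) by (auto simp only: reads_append[of E p "w @ [y]"] reads_inv_word)
    moreover have "reduced_word ((w @ [y]) @ ?z)"
    proof (cases i)
      case 0
      then show ?thesis using red_y by (simp add: inv_word_def)
    next
      case (Suc j)
      then have j: "j < length w" using i(1) by simp
      have tj: "take i w = take j w @ [w ! j]" using j by (simp add: Suc take_Suc_conv_app_nth)
      have "reduced_word (take i w)"
        using red reduced_append_iff[of "take i w" "drop i w"] by simp
      then have "reduced_word ?z" by (simp only: reduced_inv_word)
      moreover have "hd ?z = inv_letter (w ! j)" by (simp add: tj inv_word_def)
      moreover have "w ! j \<noteq> y"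
      proof
        assume wj: "w ! j = y"
        obtain u v where u: "reads E p (take j w) u" "edge u (w ! j) v \<in> E" "reads E p (take (Suc j) w) v"
          using reads_nth[OF r j] .
        have "v = t" using reads_unique[OF g(1) u(3)] i(2) Suc by blast
        then have "edge t (inv_letter y) u \<in> E" "edge t (inv_letter y) q \<in> E"
          using u(2) wj less.prems(2) by (simp_all add: edge_inv_letter)
        then have "u = q" by (rule edge_unique[OF g(1)])
        then have "j = length w"
          using simple_pathD[OF less.prems(1), of j "length w" q] u(1) r j by simp
        then show False using j by simp
      qed
      ultimately show ?thesis
        using red_y reduced_append_iff[of "w @ [y]" ?z] by (simp add: inv_letter_eq_iff)
    qed
    ultimately show ?thesis by auto
  next
    case False
    have sp: "simple_path E p (w @ [y]) t"
      unfolding simple_path_def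
    proof (intro conjI allI impI)
      show "reads E p (w @ [y]) t" by (rule r_y)
      fix i j v
      assume ij: "i \<le> length (w @ [y])" "j \<le> length (w @ [y])"
        and v: "reads E p (take i (w @ [y])) v" "reads E p (take j (w @ [y])) v"
      \<comment> \<open>The new vertex \<open>t\<close> was not visited before the last letter.\<close>
      have new: "False" if "k \<le> length w" "l = Suc (length w)"
        "reads E p (take k (w @ [y])) v" "reads E p (take l (w @ [y])) v" for k l
      proof -
        have "v = t" using reads_unique[OF g(1) _ r_y] that(2,4) by simp
        then show False using False that(1,3) by auto
      qed
      show "i = j"
      proof (cases "i \<le> length w")
        case True
        then show ?thesis
        proof (cases "j \<le> length w")
          case True
          then show ?thesis using simple_pathD[OF less.prems(1), of i j v] \<open>i \<le> length w\<close> v by simp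
        next
          case False
          then show ?thesis using new[OF True _ v] ij by simp
        qed
      next
        case False
        then show ?thesis using new[of j i] ij v by (cases "j \<le> length w") auto
      qed
    qed
    have "t \<noteq> p" using False by (metis le0 reads.simps(1) take0)
    moreover have "t \<in> V" using edge_mem_graph(2)[OF g(1) less.prems(2)] .
    ultimately have "\<not> is_leaf E t" using adm by (auto simp: admissible_def)
    then obtain x x' where "x \<in> letters_at E t" "x' \<in> letters_at E t" "x \<noteq> x'"
      using is_leaf_iff[OF g(1) finE] by blast
    then obtain y' where "y' \<in> letters_at E t" "y' \<noteq> inv_letter y" by metis
    then obtain t' where y': "edge t y' t' \<in> E" "y' \<noteq> inv_letter y" by (auto simp: letters_at_def)
    have "card V - length (w @ [y]) < card V - length w"
      using simple_path_length[OF g(1,2,3) less.prems(1)] by simp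
    from less.hyps[OF this sp y'(1)] y'(2) show ?thesis by auto
  qed
qed

text \<open>
  Let \<open>w\<close> be a simple path from the root to \<open>s\<close>.  Either \<open>x\<close> does not backtrack after \<open>w\<close>, and \<open>w x\<close> extends to
  a reduced loop; or \<open>w\<close> itself ends with the edge in question, traversed backwards, and the inverse of a
  reduced loop extending \<open>w\<close> traverses it forwards.
\<close>

lemma edge_on_reduced_loop:
  assumes adm: "admissible A V E p" and fin: "finite A" and e: "edge s x t \<in> E"
  obtains u z where "reduced_word (u @ x # z)" "reads E p u s" "reads E t z p"
proof -
  have g: "is_graph A V E" "finite V" "is_connected V E" "p \<in> V" using adm by (auto simp: admissible_def)
  have s: "s \<in> V" using edge_mem_graph(1)[OF g(1) e] .
  obtain w where w: "simple_path E p w s" using simple_path_exists[OF g(1,3,4) s] .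
  have r: "reads E p w s" using w by (simp add: simple_path_def)
  show ?thesis
  proof (cases "w = [] \<or> x \<noteq> inv_letter (last w)")
    case True
    obtain z where z: "reduced_word (w @ x # z)" "reads E p (w @ x # z) p"
      using simple_path_extends_to_loop[OF adm fin w e True] by blast
    then obtain s' t' where "reads E p w s'" "edge s' x t' \<in> E" "reads E t' z p"
      unfolding reads_append reads_Cons by blast
    moreover from this have "s' = s" using reads_unique[OF g(1) _ r] by blast
    ultimately have "reads E t z p" using edge_unique[OF g(1) e] by metis
    then show ?thesis using that[OF z(1) r] by blast
  next
    case False
    define w' where "w' = butlast w"
    have ww: "w = w' @ [inv_letter x]"
      using False by (metis append_butlast_last_id inv_letter_inv_letter w'_def)
    have red: "reduced_word w" using simple_path_reduced[OF g(1) w] .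
    obtain t' where t': "reads E p w' t'" "edge t' (inv_letter x) s \<in> E"
      using r unfolding ww reads_append reads_Cons by auto
    then have "t' = t" using e edge_unique[OF g(1)] by (metis edge_inv_letter)
    note t' = t'[unfolded this]
    have w': "simple_path E p w' t"
      unfolding simple_path_def
    proof (intro conjI allI impI)
      fix i j v assume "i \<le> length w'" "j \<le> length w'" "reads E p (take i w') v" "reads E p (take j w') v"
      then show "i = j" using simple_pathD[OF w, of i j v] by (simp add: ww)
    qed (rule t'(1))
    have "w' = [] \<or> inv_letter x \<noteq> inv_letter (last w')"
      using red unfolding ww reduced_append_iff by auto
    then obtain z where z: "reduced_word (w' @ inv_letter x # z)" "reads E p (w' @ inv_letter x # z) p"
      using simple_path_extends_to_loop[OF adm fin w' t'(2)] by blast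
    then obtain t'' s'' where "reads E p w' t''" "edge t'' (inv_letter x) s'' \<in> E" "reads E s'' z p"
      unfolding reads_append reads_Cons by blast
    moreover from this have "t'' = t" using reads_unique[OF g(1) _ t'(1)] by blast
    ultimately have zs: "reads E s z p" using edge_unique[OF g(1) t'(2)] by metis
    have "inv_word z @ x # inv_word w' = inv_word (w' @ inv_letter x # z)"
      by (simp add: inv_word_def)
    then have "reduced_word (inv_word z @ x # inv_word w')" using z(1) by (simp add: reduced_inv_word)
    then show ?thesis using that zs t'(1) by (simp add: reads_inv_word)
  qed
qed

section \<open>Uniqueness of the Stallings graph\<close>

definition relabel :: "('v \<Rightarrow> 'w) \<Rightarrow> ('v \<times> 'a \<times> 'v) set \<Rightarrow> ('w \<times> 'a \<times> 'w) set" where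
  "relabel f E = (\<lambda>(u, a, v). (f u, a, f v)) ` E"

lemma relabel_edge: "(\<lambda>(u, a, v). (f u, a, f v)) (edge p x q) = edge (f p) x (f q)"
  by (simp add: edge_def)

lemma edge_relabel: "edge p x q \<in> E \<Longrightarrow> edge (f p) x (f q) \<in> relabel f E"
  unfolding relabel_def relabel_edge[symmetric] by (rule imageI)

lemma reads_relabel: "reads E p w q \<Longrightarrow> reads (relabel f E) (f p) w (f q)"
proof (induction w arbitrary: p)
  case (Cons x w)
  then show ?case unfolding reads_Cons using edge_relabel by metis
qed simp

lemma reads_mono: "E \<subseteq> E' \<Longrightarrow> reads E p w q \<Longrightarrow> reads E' p w q"
proof (induction w arbitrary: p)
  case (Cons x w)
  then show ?case unfolding reads_Cons by (metis subsetD)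
qed simp

text \<open>
  Only the values of the relabelling on the vertices matter.
\<close>

lemma relabel_id: "(\<And>v. v \<in> V \<Longrightarrow> f v = v) \<Longrightarrow> E \<subseteq> V \<times> A \<times> V \<Longrightarrow> relabel f E = E"
  unfolding relabel_def by (rule trans[OF image_cong[OF refl] image_ident]) auto

lemma relabel_relabel: "relabel f (relabel g E) = relabel (f \<circ> g) E"
  by (auto simp: relabel_def image_image split_beta)

text \<open>
  Match a vertex \<open>v\<close> of \<open>E\<close> with a vertex \<open>v'\<close> of \<open>E'\<close> if some element of the free group is read from the root to \<open>v\<close> in
  \<open>E\<close> and to \<open>v'\<close> in \<open>E'\<close>.  If \<open>u\<^sub>1\<close> and \<open>u\<^sub>2\<close> lead to the same vertex in \<open>E\<close>, then \<open>u\<^sub>1 u\<^sub>2\<^sup>-\<^sup>1\<close> lies in the common subgroup,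
  so they lead to the same vertex in \<open>E'\<close>; thus the matching is a function, and by symmetry it is injective.  An edge
  lies on a reduced loop, which is an element of the subgroup and hence is also a loop in the other graph; so
  the matching reaches all edges and respects them.
\<close>

lemma stallings_graph_unique:
  assumes adm: "admissible A V E p" "admissible A V' E' p'" and fin: "finite A"
    and eq: "loop_subgroup A E p = loop_subgroup A E' p'"
  obtains f where "bij_betw f V V'" "f p = p'" "relabel f E = E'"
proof -
  let ?G = "free_group A"
  interpret group ?G by (rule group_free_group)
  define \<phi> where "\<phi> v v' \<longleftrightarrow> (\<exists>u\<in>carrier ?G. reads E p u v \<and> reads E' p' u v')" for v v'
  have g: "is_graph A V E" "p \<in> V" "is_connected V E" and g': "is_graph A V' E'" "p' \<in> V'" "is_connected V' E'"
    using adm by (auto simp: admissible_def)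
  have loops: "reads E p u p \<longleftrightarrow> reads E' p' u p'" if "u \<in> carrier ?G" for u
    using eq that by (auto simp: loop_subgroup_def)
  \<comment> \<open>Stated for two arbitrary graphs with the same loops, so that it can be used in both directions;
    likewise for \<open>transfer\<close>.\<close>
  have unique: "v' = v''"
    if G: "is_graph A W F" "is_graph A W' F'" and L: "\<And>u. u \<in> carrier ?G \<Longrightarrow> reads F q u q \<longleftrightarrow> reads F' q' u q'"
      and u: "u1 \<in> carrier ?G" "reads F q u1 v" "reads F' q' u1 v'"
        "u2 \<in> carrier ?G" "reads F q u2 v" "reads F' q' u2 v''"
    for W W' F F' q q' u1 u2 v v' v''
  proof -
    let ?u = "u1 \<otimes>\<^bsub>?G\<^esub> inv\<^bsub>?G\<^esub> u2"
    have "reads F q ?u q"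
      using reads_mult[OF G(1) u(2)] reads_inv_free_group[OF u(4)] u(5) by metis
    then have "reads F' q' ?u q'" using L u(1,4) by simp
    then have "reads F' q' (?u \<otimes>\<^bsub>?G\<^esub> u2) v''" using reads_mult[OF G(2)] u(6) by metis
    moreover have "?u \<otimes>\<^bsub>?G\<^esub> u2 = u1" using u(1,4) by (simp add: m_assoc)
    ultimately show ?thesis using reads_unique[OF G(2) u(3)] by simp
  qed
  have func: "v' = v''" if "\<phi> v v'" "\<phi> v v''" for v v' v''
    using that unique[OF g(1) g'(1) loops] unfolding \<phi>_def by metis
  have inj: "u = v" if "\<phi> u v'" "\<phi> v v'" for u v v'
    using that unique[OF g'(1) g(1) loops[symmetric]] unfolding \<phi>_def by metis
  have transfer: "\<exists>u\<in>carrier ?G. \<exists>w\<in>carrier ?G. \<exists>s' t'. reads F q u s \<and> reads F q w t \<and>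
      reads F' q' u s' \<and> reads F' q' w t' \<and> edge s' x t' \<in> F'"
    if a: "admissible A W F q" and L: "\<And>u. u \<in> carrier ?G \<Longrightarrow> reads F q u q \<longleftrightarrow> reads F' q' u q'"
      and e: "edge s x t \<in> F" for W F F' q q' s x t
  proof -
    obtain u z where u: "reduced_word (u @ x # z)" "reads F q u s" "reads F t z q"
      using edge_on_reduced_loop[OF a fin e] .
    have G: "is_graph A W F" "q \<in> W" using a by (auto simp: admissible_def)
    have "reads F q (u @ x # z) q" unfolding reads_append reads_Cons using u e by blast
    moreover from this have c: "u @ x # z \<in> carrier ?G"
      using reads_mem_graph(2)[OF G] u(1) unfolding mem_free_group by blast
    ultimately have "reads F' q' (u @ x # z) q'" using L by blast
    then obtain s' t' where st: "reads F' q' u s'" "edge s' x t' \<in> F'" "reads F' t' z q'"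
      unfolding reads_append reads_Cons by blast
    have "reads F q (u @ [x]) t" "reads F' q' (u @ [x]) t'"
      unfolding reads_append reads_Cons using u e st by auto
    moreover have "u \<in> carrier ?G" using c by (auto simp: mem_free_group reduced_append_iff)
    moreover have "u @ [x] \<in> carrier ?G"
      using c reduced_append_iff[of "u @ [x]" z] by (auto simp: mem_free_group)
    ultimately show ?thesis using st u by blast
  qed
  have E: "\<exists>s' t'. \<phi> s s' \<and> \<phi> t t' \<and> edge s' x t' \<in> E'" if "edge s x t \<in> E" for s x t
    using transfer[OF adm(1) loops that] unfolding \<phi>_def by blast
  have E': "\<exists>s t. \<phi> s s' \<and> \<phi> t t' \<and> edge s x t \<in> E" if "edge s' x t' \<in> E'" for s' x t'
    using transfer[OF adm(2) loops[symmetric] that] unfolding \<phi>_def by blast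
  have "\<phi> p p'" unfolding \<phi>_def using one_closed unfolding one_free_group by force
  have finE: "finite E" "finite E'"
    using adm finite_graph_edges[OF g(1) fin] finite_graph_edges[OF g'(1) fin] by (auto simp: admissible_def)
  have total: "\<exists>v'. \<phi> v v'" if "v \<in> V" for v
  proof (cases "v = p")
    case False
    then have "\<not> is_leaf E v" using adm(1) that by (auto simp: admissible_def)
    then obtain x u where "edge v x u \<in> E"
      unfolding is_leaf_iff[OF g(1) finE(1)] letters_at_def by blast
    then show ?thesis using E by blast
  qed (use \<open>\<phi> p p'\<close> in blast)
  have surj: "\<exists>v. \<phi> v v'" if "v' \<in> V'" for v'
  proof (cases "v' = p'")
    case False
    then have "\<not> is_leaf E' v'" using adm(2) that by (auto simp: admissible_def)
    then obtain x u where "edge v' x u \<in> E'"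
      unfolding is_leaf_iff[OF g'(1) finE(2)] letters_at_def by blast
    then show ?thesis using E' by blast
  qed (use \<open>\<phi> p p'\<close> in blast)
  have dom: "v \<in> V" "v' \<in> V'" if "\<phi> v v'" for v v'
    using that reads_mem_graph(1)[OF g(1,2)] reads_mem_graph(1)[OF g'(1,2)] unfolding \<phi>_def by blast+
  define f where "f v = (THE v'. \<phi> v v')" for v
  have f: "f v = v'" if "\<phi> v v'" for v v'
    unfolding f_def by (rule the_equality[where P = "\<phi> v", OF that]) (rule func[OF _ that])
  have "bij_betw f V V'"
    unfolding bij_betw_def inj_on_def
  proof (intro conjI ballI impI)
    fix u v assume "u \<in> V" "v \<in> V" "f u = f v"
    then show "u = v" using total f inj by metis
  next
    show "f ` V = V'"
    proof (intro Set.set_eqI iffI)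
      fix v' assume "v' \<in> f ` V" then show "v' \<in> V'" using total f dom(2) by blast
    next
      fix v' assume "v' \<in> V'" then show "v' \<in> f ` V" using surj f dom(1) by blast
    qed
  qed
  moreover have "relabel f E = E'"
  proof (intro Set.set_eqI iffI)
    fix e assume "e \<in> relabel f E"
    then obtain u a v where e: "(u, a, v) \<in> E" "e = (f u, a, f v)" by (auto simp: relabel_def)
    then obtain s' t' where "\<phi> u s'" "\<phi> v t'" "edge s' (a, True) t' \<in> E'"
      using E[of u "(a, True)" v] unfolding triple_eq_edge by blast
    then show "e \<in> E'" using e f by (simp add: triple_eq_edge)
  next
    fix e assume e: "e \<in> E'"
    obtain s' a t' where e': "e = (s', a, t')" by (cases e)
    then obtain u v where "\<phi> u s'" "\<phi> v t'" "edge u (a, True) v \<in> E"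
      using E'[of s' "(a, True)" t'] e unfolding triple_eq_edge by blast
    then show "e \<in> relabel f E" using f edge_relabel[of u "(a, True)" v E f] e' by (simp add: triple_eq_edge)
  qed
  ultimately show ?thesis using that f[OF \<open>\<phi> p p'\<close>] by blast
qed

section \<open>Existence of the Stallings graph\<close>

lemma is_graph_subset: "is_graph A V E \<Longrightarrow> F \<subseteq> E \<Longrightarrow> F \<subseteq> W \<times> A \<times> W \<Longrightarrow> is_graph A W F"
  unfolding is_graph_def by blast

text \<open>
  The generators act by right translation.  This action is defined on all subsets of the free group, and its
  restriction to the right cosets of a subgroup is the Schreier graph of that subgroup.
\<close>

definition schreier_edges :: "'a set \<Rightarrow> ('a word set \<times> 'a \<times> 'a word set) set" where
  "schreier_edges A = {(C, a, C #>\<^bsub>free_group A\<^esub> [(a, True)]) | C a. C \<subseteq> carrier (free_group A) \<and> a \<in> A}"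

lemma edge_schreier:
  assumes "C \<subseteq> carrier (free_group A)" "fst x \<in> A"
  shows "edge C x (C #>\<^bsub>free_group A\<^esub> [x]) \<in> schreier_edges A"
proof -
  interpret group "free_group A" by (rule group_free_group)
  let ?D = "C #>\<^bsub>free_group A\<^esub> [x]"
  have D: "?D \<subseteq> carrier (free_group A)" using assms by (intro r_coset_subset_G letter_mem)
  show ?thesis
  proof (cases "snd x")
    case True
    then have "edge C x ?D = (C, fst x, C #>\<^bsub>free_group A\<^esub> [(fst x, True)])"
      by (cases x) (simp add: edge_def)
    then show ?thesis using assms unfolding schreier_edges_def by blast
  next
    case False
    then have x: "[(fst x, True)] = inv\<^bsub>free_group A\<^esub> [x]"
      using assms(2) by (simp add: inv_letter_free_group inv_letter_def)
    have "?D #>\<^bsub>free_group A\<^esub> [(fst x, True)] = C"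
      unfolding x using assms letter_mem[of x A] by (simp add: coset_mult_assoc)
    then have "edge C x ?D = (?D, fst x, ?D #>\<^bsub>free_group A\<^esub> [(fst x, True)])"
      using False by (simp add: edge_def)
    then show ?thesis using assms(2) D unfolding schreier_edges_def by blast
  qed
qed

lemma is_graph_schreier: "is_graph A (Pow (carrier (free_group A))) (schreier_edges A)"
proof -
  interpret group "free_group A" by (rule group_free_group)
  have sub: "C #>\<^bsub>free_group A\<^esub> [(a, True)] \<subseteq> carrier (free_group A)"
    if "C \<subseteq> carrier (free_group A)" "a \<in> A" for C a
    using that by (intro r_coset_subset_G letter_mem) auto
  have inj: "C = D" if "C \<subseteq> carrier (free_group A)" "D \<subseteq> carrier (free_group A)" "a \<in> A"
    "C #>\<^bsub>free_group A\<^esub> [(a, True)] = D #>\<^bsub>free_group A\<^esub> [(a, True)]" for C D a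
  proof -
    let ?a = "[(a, True)]"
    have a: "?a \<in> carrier (free_group A)" using that(3) by (simp add: letter_mem)
    have "C #>\<^bsub>free_group A\<^esub> ?a #>\<^bsub>free_group A\<^esub> inv\<^bsub>free_group A\<^esub> ?a =
        D #>\<^bsub>free_group A\<^esub> ?a #>\<^bsub>free_group A\<^esub> inv\<^bsub>free_group A\<^esub> ?a"
      using that(4) by simp
    then show ?thesis using that(1,2) a by (simp add: coset_mult_assoc)
  qed
  show ?thesis
    unfolding is_graph_def
  proof (intro conjI allI impI)
    show "schreier_edges A \<subseteq> Pow (carrier (free_group A)) \<times> A \<times> Pow (carrier (free_group A))"
      unfolding schreier_edges_def using sub by blast
    fix C a D D' assume "(C, a, D) \<in> schreier_edges A \<and> (C, a, D') \<in> schreier_edges A"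
    then show "D = D'" by (simp add: schreier_edges_def)
  next
    fix C C' a D assume "(C, a, D) \<in> schreier_edges A \<and> (C', a, D) \<in> schreier_edges A"
    then have C: "C \<subseteq> carrier (free_group A)" "C' \<subseteq> carrier (free_group A)" "a \<in> A"
      and "D = C #>\<^bsub>free_group A\<^esub> [(a, True)]" "D = C' #>\<^bsub>free_group A\<^esub> [(a, True)]"
      unfolding schreier_edges_def by blast+
    then have "C #>\<^bsub>free_group A\<^esub> [(a, True)] = C' #>\<^bsub>free_group A\<^esub> [(a, True)]" by metis
    then show "C = C'" by (rule inj[OF C])
  qed
qed

text \<open>
  Reading a word in the Schreier graph is translating by it.
\<close>

lemma reads_schreier:
  assumes "C \<subseteq> carrier (free_group A)" "reads (schreier_edges A) C w D" "reduced_word w"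
  shows "D = C #>\<^bsub>free_group A\<^esub> w"
  using assms
proof (induction w arbitrary: C)
  case Nil
  interpret group "free_group A" by (rule group_free_group)
  have "C #>\<^bsub>free_group A\<^esub> [] = C" using coset_mult_one[OF Nil(1)] by (simp add: one_free_group)
  then show ?case using Nil(2) by simp
next
  case (Cons x w)
  interpret group "free_group A" by (rule group_free_group)
  obtain C' where C': "edge C x C' \<in> schreier_edges A" "reads (schreier_edges A) C' w D"
    using Cons.prems(2) unfolding reads_Cons by blast
  have C: "C' \<subseteq> carrier (free_group A)" "fst x \<in> A" "C \<in> Pow (carrier (free_group A))"
    using edge_mem_graph[OF is_graph_schreier C'(1)] by auto
  have C'eq: "C' = C #>\<^bsub>free_group A\<^esub> [x]"
    using edge_unique[OF is_graph_schreier C'(1)] edge_schreier[OF Cons.prems(1) C(2)] by blast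
  have w: "w \<in> carrier (free_group A)"
    using reads_mem_graph(2)[OF is_graph_schreier _ C'(2)] C(1) reduced_ConsD[OF Cons.prems(3)]
    by (simp add: mem_free_group)
  have "D = C' #>\<^bsub>free_group A\<^esub> w" using Cons.IH[OF C(1) C'(2)] reduced_ConsD[OF Cons.prems(3)] by blast
  then show ?case
    unfolding C'eq Cons_eq_mult[OF Cons.prems(3), of A]
    using Cons.prems(1) w letter_mem[OF C(2)] by (simp add: coset_mult_assoc)
qed

text \<open>
  The graph consists of the part of the Schreier graph of \<open>H\<close> that is traversed by the finitely many generators,
  starting at the coset \<open>H\<close>.  An inner vertex on the path of a reduced generator is entered and left by
  different incident letters, so only the root can be a leaf.  The loops at \<open>H\<close> include the generators, and each of
  them fixes the coset \<open>H\<close>, that is, lies in \<open>H\<close>.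
\<close>

lemma stallings_graph_of_cosets:
  assumes "finite S" "S \<subseteq> carrier (free_group A)"
  shows "\<exists>V E. is_stallings_graph A (generate (free_group A) S) V E (generate (free_group A) S)"
proof -
  let ?G = "free_group A"
  interpret group ?G by (rule group_free_group)
  define H where "H = generate ?G S"
  have H: "subgroup H ?G" unfolding H_def by (rule generate_is_subgroup[OF assms(2)])
  have HG: "H \<subseteq> carrier ?G" using H by (rule subgroup.subset)
  define c where "c w = H #>\<^bsub>?G\<^esub> w" for w
  define V where "V = insert H (\<Union>s\<in>S. (\<lambda>i. c (take i s)) ` {..length s})"
  define E where "E = (\<Union>s\<in>S. (\<lambda>i. edge (c (take i s)) (s ! i) (c (take (Suc i) s))) ` {..<length s})"
  have V: "c (take i s) \<in> V" if "s \<in> S" "i \<le> length s" for i s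
    using that unfolding V_def by blast
  have finV: "finite V" and finE: "finite E" using assms(1) by (simp_all add: V_def E_def)
  have S: "take i s \<in> carrier ?G" "fst ` set s \<subseteq> A" if "s \<in> S" for s i
  proof -
    have "s \<in> carrier ?G" using assms(2) that by blast
    then have "reduced_word s" "fst ` set s \<subseteq> A" by (simp_all only: mem_free_group)
    then show "take i s \<in> carrier ?G" "fst ` set s \<subseteq> A"
      using reduced_append_iff[of "take i s" "drop i s"] image_mono[OF set_take_subset[of i s], of fst]
      unfolding mem_free_group by simp_all
  qed
  have c0: "c [] = H" unfolding c_def using coset_mult_one[OF HG] by (simp flip: one_free_group[of A])
  have cS: "c s = H" if "s \<in> S" for s
    unfolding c_def using that coset_join2[OF _ H] assms(2) generate.incl[of s S ?G] by (auto simp: H_def)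
  have edges: "edge (c (take i s)) (s ! i) (c (take (Suc i) s)) \<in> E" if "s \<in> S" "i < length s" for s i
    using that by (auto simp: E_def)
  have E_sub: "E \<subseteq> schreier_edges A"
  proof
    fix e assume "e \<in> E"
    then obtain s i where s: "s \<in> S" "i < length s" and e: "e = edge (c (take i s)) (s ! i) (c (take (Suc i) s))"
      by (auto simp: E_def)
    have x: "fst (s ! i) \<in> A" using S(2)[OF s(1)] s(2) nth_mem by blast
    have "take (Suc i) s = take i s \<otimes>\<^bsub>?G\<^esub> [s ! i]"
      using S(1)[OF s(1), of "Suc i"] s(2)
      by (simp add: take_Suc_conv_app_nth mult_free_group mem_free_group word_mult_reduced)
    then have "c (take (Suc i) s) = c (take i s) #>\<^bsub>?G\<^esub> [s ! i]"
      unfolding c_def using coset_mult_assoc[OF HG S(1)[OF s(1), of i] letter_mem[OF x]] by simp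
    then show "e \<in> schreier_edges A"
      unfolding e using edge_schreier[of "c (take i s)" A "s ! i"] x
        r_coset_subset_G[OF HG S(1)[OF s(1), of i]] by (simp add: c_def)
  qed
  have VE: "E \<subseteq> V \<times> A \<times> V"
  proof
    fix e assume "e \<in> E"
    then obtain s i where s: "s \<in> S" "i < length s" and e: "e = edge (c (take i s)) (s ! i) (c (take (Suc i) s))"
      by (auto simp: E_def)
    have "c (take i s) \<in> V" "c (take (Suc i) s) \<in> V" using s V[OF s(1)] by simp_all
    moreover have "fst (s ! i) \<in> A" using S(2)[OF s(1)] s(2) nth_mem by blast
    ultimately show "e \<in> V \<times> A \<times> V" by (simp add: e edge_def)
  qed
  have graph: "is_graph A V E" by (rule is_graph_subset[OF is_graph_schreier E_sub VE])
  have rd: "reads E H (take i s) (c (take i s))" if "s \<in> S" "i \<le> length s" for s i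
    using that(2)
  proof (induction i)
    case 0
    show ?case by (simp add: c0)
  next
    case (Suc i)
    then have i: "i < length s" by simp
    then show ?case
      using Suc edges[OF that(1) i] by (auto simp add: take_Suc_conv_app_nth reads_append reads_Cons simp del: reads.simps(2,3))
  qed
  have conn: "is_connected V E"
  proof (rule connectedI[of V E H])
    fix v assume "v \<in> V"
    then show "\<exists>w. reads E H w v"
      unfolding V_def using rd reads.simps(1)[of E H H] by blast
  qed
  have noleaf: "\<not> is_leaf E v" if vV: "v \<in> V" "v \<noteq> H" for v
  proof -
    obtain s i where s: "s \<in> S" "i \<le> length s" and v: "v = c (take i s)"
      using vV unfolding V_def by blast
    have "i \<noteq> 0" using vV(2) c0 v by auto
    then obtain j where j: "i = Suc j" by (cases i) auto
    have "i \<noteq> length s" using vV(2) cS[OF s(1)] v by auto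
    then have i: "Suc j < length s" using s(2) j by simp
    have "edge (c (take j s)) (s ! j) v \<in> E" "edge v (s ! i) (c (take (Suc i) s)) \<in> E"
      using edges[OF s(1), of j] edges[OF s(1), of i] i v j by simp_all
    then have "inv_letter (s ! j) \<in> letters_at E v" "s ! i \<in> letters_at E v"
      by (auto simp: letters_at_def edge_inv_letter)
    moreover have "reduced_word s" using assms(2) s(1) by (auto simp: mem_free_group)
    then have "s ! i \<noteq> inv_letter (s ! j)"
      using i unfolding j reduced_iff_successively successively_conv_nth by blast
    ultimately show ?thesis unfolding is_leaf_iff[OF graph finE] by metis
  qed
  have adm: "admissible A V E H"
    unfolding admissible_def using graph finV conn noleaf by (simp add: V_def)
  moreover have "H = loop_subgroup A E H"
  proof
    have "S \<subseteq> loop_subgroup A E H"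
    proof
      fix s assume "s \<in> S"
      then show "s \<in> loop_subgroup A E H"
        using rd[of s "length s"] cS[of s] assms(2) by (auto simp: loop_subgroup_def)
    qed
    then show "H \<subseteq> loop_subgroup A E H"
      unfolding H_def by (rule generate_subgroup_incl) (rule subgroup_loop_subgroup[OF graph])
    show "loop_subgroup A E H \<subseteq> H"
    proof
      fix u assume "u \<in> loop_subgroup A E H"
      then have u: "u \<in> carrier ?G" "reads (schreier_edges A) H u H"
        using reads_mono[OF E_sub] by (auto simp: loop_subgroup_def)
      then have "H #>\<^bsub>?G\<^esub> u = H" using reads_schreier[OF HG u(2)] by (simp add: mem_free_group)
      then show "u \<in> H" using coset_join1[OF _ u(1) H] by simp
    qed
  qed
  ultimately show ?thesis
    unfolding is_stallings_graph_iff[OF HG, unfolded H_def] unfolding H_def by blast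
qed

section \<open>Relabelled graphs\<close>

lemma relabel_inv_into:
  assumes "inj_on f V" "E \<subseteq> V \<times> A \<times> V"
  shows "relabel (inv_into V f) (relabel f E) = E"
  unfolding relabel_relabel using assms by (intro relabel_id[of V]) auto

lemma reads_relabel_iff:
  assumes "is_graph A V E" "inj_on f V" "p \<in> V" "q \<in> V"
  shows "reads (relabel f E) (f p) w (f q) \<longleftrightarrow> reads E p w q"
proof
  assume "reads (relabel f E) (f p) w (f q)"
  then have "reads (relabel (inv_into V f) (relabel f E)) (inv_into V f (f p)) w (inv_into V f (f q))"
    by (rule reads_relabel)
  then show "reads E p w q"
    using assms relabel_inv_into[of f V E A] by (simp add: is_graph_def)
qed (rule reads_relabel)

lemma loop_subgroup_relabel:
  assumes "is_graph A V E" "inj_on f V" "p \<in> V"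
  shows "loop_subgroup A (relabel f E) (f p) = loop_subgroup A E p"
  using reads_relabel_iff[OF assms assms(3)] by (simp add: loop_subgroup_def)

lemma is_graph_relabel:
  assumes "is_graph A V E" "inj_on f V"
  shows "is_graph A (f ` V) (relabel f E)"
proof -
  have E: "E \<subseteq> V \<times> A \<times> V" using assms(1) by (simp add: is_graph_def)
  have rel: "\<exists>u\<in>V. \<exists>v\<in>V. a \<in> A \<and> u' = f u \<and> v' = f v \<and> (u, a, v) \<in> E" if "(u', a, v') \<in> relabel f E" for u' a v'
    using that E by (fastforce simp: relabel_def)
  have out: "v = v'" if "(u, a, v) \<in> E" "(u, a, v') \<in> E" for u a v v'
    using assms(1) that unfolding is_graph_def by blast
  have into: "u = u'" if "(u, a, v) \<in> E" "(u', a, v) \<in> E" for u u' a v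
    using assms(1) that unfolding is_graph_def by blast
  show ?thesis
    unfolding is_graph_def
  proof (intro conjI allI impI)
    show "relabel f E \<subseteq> f ` V \<times> A \<times> f ` V" using E by (auto simp: relabel_def)
    fix u' a v1 v2 assume "(u', a, v1) \<in> relabel f E \<and> (u', a, v2) \<in> relabel f E"
    then show "v1 = v2" using rel[of u' a v1] rel[of u' a v2] out inj_onD[OF assms(2)] by metis
  next
    fix u1 u2 a v' assume "(u1, a, v') \<in> relabel f E \<and> (u2, a, v') \<in> relabel f E"
    then show "u1 = u2" using rel[of u1 a v'] rel[of u2 a v'] into inj_onD[OF assms(2)] by metis
  qed
qed

lemma admissible_relabel:
  assumes "admissible A V E p" "finite A" "inj_on f V"
  shows "admissible A (f ` V) (relabel f E) (f p)"
proof -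
  have g: "is_graph A V E" "finite V" "is_connected V E" "p \<in> V" using assms(1) by (auto simp: admissible_def)
  have g': "is_graph A (f ` V) (relabel f E)" by (rule is_graph_relabel[OF g(1) assms(3)])
  have fin: "finite E" "finite (relabel f E)"
    using finite_graph_edges[OF g(1) assms(2) g(2)] by (simp_all add: relabel_def)
  have "is_connected (f ` V) (relabel f E)"
  proof (rule connectedI[of _ _ "f p"])
    fix v' assume "v' \<in> f ` V"
    then obtain v where v: "v \<in> V" "v' = f v" by blast
    obtain w where w: "reads E p w v" using connected_reads[OF g(1,3,4) v(1)] .
    show "\<exists>w. reads (relabel f E) (f p) w v'" unfolding v(2) using reads_relabel[OF w] by (rule exI)
  qed
  moreover have "\<not> is_leaf (relabel f E) v'" if v': "v' \<in> f ` V" "v' \<noteq> f p" for v'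
  proof -
    obtain v where v: "v \<in> V" "v' = f v" "v \<noteq> p" using v' by blast
    then have "\<not> is_leaf E v" using assms(1) by (auto simp: admissible_def)
    then obtain x y where xy: "x \<in> letters_at E v" "y \<in> letters_at E v" "x \<noteq> y"
      unfolding is_leaf_iff[OF g(1) fin(1)] by blast
    have "letters_at E v \<subseteq> letters_at (relabel f E) (f v)"
      using edge_relabel[of v _ _ E f] by (auto simp: letters_at_def)
    then show ?thesis unfolding is_leaf_iff[OF g' fin(2)] v(2) using xy by blast
  qed
  ultimately show ?thesis unfolding admissible_def using g g' by simp
qed

section \<open>Loops and conjugates of generators\<close>

text \<open>
  If \<open>g\<close> starts with \<open>a\<close> or its inverse, that letter commutes with \<open>a\<close> and can be dropped from \<open>g\<close>.  Otherwise
  the word \<open>g\<^sup>-\<^sup>1 a g\<close> is reduced as it stands, and is a loop at \<open>p\<close>.  Its first and its last part are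
  paths between \<open>p\<close> and the same vertex, by determinism, so the middle edge is a loop.
\<close>

lemma reads_conjugate_imp_loop:
  assumes "is_graph A V E" "g \<in> carrier (free_group A)" "a \<in> A"
    "reads E p (inv\<^bsub>free_group A\<^esub> g \<otimes>\<^bsub>free_group A\<^esub> generator a \<otimes>\<^bsub>free_group A\<^esub> g) p"
  shows "\<exists>v. (v, a, v) \<in> E"
  using assms(2,4)
proof (induction g)
  case Nil
  interpret group "free_group A" by (rule group_free_group)
  have "generator a \<in> carrier (free_group A)" using letter_mem[of "(a, True)" A] assms(3) by (simp add: generator_def)
  then have "reads E p (generator a) p"
    using Nil by (simp flip: one_free_group[of A])
  then show ?case by (auto simp: generator_def)
next
  case (Cons x g)
  let ?G = "free_group A"
  interpret group ?G by (rule group_free_group)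
  have g: "g \<in> carrier ?G" "fst x \<in> A" "reduced_word (x # g)" "x # g \<in> carrier ?G"
    using Cons.prems(1) reduced_ConsD[of x g] by (auto simp: mem_free_group)
  have x: "[x] \<in> carrier ?G" and a: "generator a \<in> carrier ?G"
    using letter_mem[of _ A] g(2) assms(3) by (auto simp: generator_def)
  have xg: "x # g = [x] \<otimes>\<^bsub>?G\<^esub> g" by (rule Cons_eq_mult[OF g(3)])
  show ?case
  proof (cases "fst x = a")
    case True
    then have "[x] = generator a \<or> [x] = inv\<^bsub>?G\<^esub> generator a"
      using assms(3) by (cases x; cases "snd x") (auto simp: generator_def inv_letter_free_group inv_letter_def)
    then have "inv\<^bsub>?G\<^esub> [x] \<otimes>\<^bsub>?G\<^esub> generator a \<otimes>\<^bsub>?G\<^esub> [x] = generator a"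
      using a by (auto simp: m_assoc)
    moreover have "inv\<^bsub>?G\<^esub> (x # g) \<otimes>\<^bsub>?G\<^esub> generator a \<otimes>\<^bsub>?G\<^esub> (x # g) =
        inv\<^bsub>?G\<^esub> g \<otimes>\<^bsub>?G\<^esub> (inv\<^bsub>?G\<^esub> [x] \<otimes>\<^bsub>?G\<^esub> generator a \<otimes>\<^bsub>?G\<^esub> [x]) \<otimes>\<^bsub>?G\<^esub> g"
      unfolding xg using a x g(1) by (simp add: inv_mult_group m_assoc)
    ultimately show ?thesis using Cons.IH[OF g(1)] Cons.prems(2) by simp
  next
    case False
    have inv: "inv\<^bsub>?G\<^esub> (x # g) = inv_word (x # g)" by (rule inv_free_group[OF g(4)])
    have red1: "reduced_word (inv_word (x # g) @ generator a)"
      using g(3) False unfolding reduced_append_iff reduced_inv_word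
      by (auto simp: generator_def inv_word_def)
    have red2: "reduced_word ((inv_word (x # g) @ generator a) @ (x # g))"
      using red1 g(3) False unfolding reduced_append_iff[of _ "x # g"]
      by (auto simp: generator_def inv_letter_def)
    have "inv\<^bsub>?G\<^esub> (x # g) \<otimes>\<^bsub>?G\<^esub> generator a \<otimes>\<^bsub>?G\<^esub> (x # g) = (inv_word (x # g) @ generator a) @ (x # g)"
      unfolding inv mult_free_group using word_mult_reduced[OF red1] word_mult_reduced[OF red2] by simp
    then have "reads E p ((inv_word (x # g) @ generator a) @ (x # g)) p"
      using Cons.prems(2) by (simp only:)
    then obtain u v where uv: "reads E u (x # g) p" "reads E p (inv_word (x # g)) v" "reads E v (generator a) u"
      unfolding reads_append by blast
    have "reads E p (inv_word (x # g)) u" using uv(1) by (simp only: reads_inv_word)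
    then have "u = v" using reads_unique[OF assms(1) _ uv(2)] by blast
    then show ?thesis using uv(3) by (auto simp: generator_def)
  qed
qed

text \<open>
  One direction is \<open>reads_conjugate_imp_loop\<close>.  For the other, an \<open>a\<close>-loop at \<open>v\<close> is reached by some \<open>w\<close> from the root, and then \<open>w a w\<^sup>-\<^sup>1\<close> lies in the subgroup.
\<close>

lemma avoids_generator_conjugates_iff_loop_free:
  assumes "admissible A V E p"
  shows "avoids_generator_conjugates A (loop_subgroup A E p) \<longleftrightarrow> (\<forall>v a. (v, a, v) \<notin> E)"
proof -
  let ?G = "free_group A"
  interpret group ?G by (rule group_free_group)
  have g: "is_graph A V E" "is_connected V E" "p \<in> V" using assms by (auto simp: admissible_def)
  show ?thesis
  proof
    assume free: "\<forall>v a. (v, a, v) \<notin> E"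
    then show "avoids_generator_conjugates A (loop_subgroup A E p)"
      unfolding avoids_generator_conjugates_def loop_subgroup_def
      using reads_conjugate_imp_loop[OF g(1)] by blast
  next
    assume avoid: "avoids_generator_conjugates A (loop_subgroup A E p)"
    show "\<forall>v a. (v, a, v) \<notin> E"
    proof (intro allI notI)
      fix v a assume e: "(v, a, v) \<in> E"
      then have va: "v \<in> V" "a \<in> A" using g(1) by (auto simp: is_graph_def)
      obtain w where w: "w \<in> carrier ?G" "reads E p w v" using connected_reads[OF g va(1)] .
      let ?g = "inv\<^bsub>?G\<^esub> w"
      have "reads E v ?g p" using w by (simp add: reads_inv_free_group)
      moreover have "reads E v (generator a) v" using e by (simp add: generator_def)
      moreover have "reads E p (inv\<^bsub>?G\<^esub> ?g) v" using w by simp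
      ultimately have "reads E p (inv\<^bsub>?G\<^esub> ?g \<otimes>\<^bsub>?G\<^esub> generator a \<otimes>\<^bsub>?G\<^esub> ?g) p"
        using reads_mult[OF g(1)] by metis
      moreover have "inv\<^bsub>?G\<^esub> ?g \<otimes>\<^bsub>?G\<^esub> generator a \<otimes>\<^bsub>?G\<^esub> ?g \<in> carrier ?G"
        using w(1) letter_mem[of "(a, True)" A] va(2) by (simp add: generator_def)
      ultimately show False
        using avoid w(1) va(2) unfolding avoids_generator_conjugates_def loop_subgroup_def by blast
    qed
  qed
qed

section \<open>Subgroups as labelled graphs\<close>

lemma finitely_generated_subset_carrier:
  "finitely_generated_subgroup A H \<Longrightarrow> H \<subseteq> carrier (free_group A)"
  unfolding finitely_generated_subgroup_def by (auto dest: subgroup.subset)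

lemma is_stallings_graph_relabel:
  assumes "is_stallings_graph A H V E p" "H \<subseteq> carrier (free_group A)" "finite A" "inj_on f V"
  shows "is_stallings_graph A H (f ` V) (relabel f E) (f p)"
proof -
  have a: "admissible A V E p" "H = loop_subgroup A E p"
    using assms(1) unfolding is_stallings_graph_iff[OF assms(2)] by blast+
  then show ?thesis
    unfolding is_stallings_graph_iff[OF assms(2)]
    using admissible_relabel[OF a(1) assms(3,4)] loop_subgroup_relabel[of A V E f p] assms(4)
    by (simp add: admissible_def)
qed

text \<open>
  The coset graph has sets of words as vertices; being finite, it can be renamed to natural numbers.
\<close>

lemma stallings_graph_exists:
  assumes "finitely_generated_subgroup A H" "finite A"
  shows "\<exists>(V :: nat set) E p. is_stallings_graph A H V E p"
proof -
  note H = finitely_generated_subset_carrier[OF assms(1)]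
  obtain S where S: "finite S" "S \<subseteq> carrier (free_group A)" "H = generate (free_group A) S"
    using assms(1) unfolding finitely_generated_subgroup_def by blast
  obtain V E where VE: "is_stallings_graph A H V E H"
    using stallings_graph_of_cosets[OF S(1,2)] unfolding S(3) by metis
  then have "finite V" by (simp add: is_stallings_graph_def admissible_def)
  then obtain f :: "'a word set \<Rightarrow> nat" where f: "inj_on f V"
    using finite_imp_inj_to_nat_seg[of V] by auto
  show ?thesis using is_stallings_graph_relabel[OF VE H assms(2) f] by (intro exI)
qed

lemma stallings_graph_is_stallings_graph:
  assumes "finitely_generated_subgroup A H" "finite A"
  obtains V E p where "stallings_graph A H = (V, E, p)" "is_stallings_graph A H V E p"
proof -
  have "case stallings_graph A H of (V, E, p) \<Rightarrow> is_stallings_graph A H V E p"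
    unfolding stallings_graph_def by (rule someI_ex) (use stallings_graph_exists[OF assms] in auto)
  then show ?thesis using that by (cases "stallings_graph A H") auto
qed

text \<open>
  By uniqueness the size does not depend on the chosen Stallings graph.
\<close>

lemma subgroup_size_eq:
  assumes "finitely_generated_subgroup A H" "finite A" "is_stallings_graph A H V E p"
  shows "subgroup_size A H = card V"
proof -
  note iff = is_stallings_graph_iff[OF finitely_generated_subset_carrier[OF assms(1)]]
  obtain W F q where W: "stallings_graph A H = (W, F, q)" "is_stallings_graph A H W F q"
    using stallings_graph_is_stallings_graph[OF assms(1,2)] .
  have "admissible A W F q" "admissible A V E p" "loop_subgroup A F q = loop_subgroup A E p"
    using W(2) assms(3) unfolding iff by blast+
  then obtain f where "bij_betw f W V"
    using stallings_graph_unique[OF _ _ assms(2)] by metis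
  then show ?thesis unfolding subgroup_size_def W(1) by (simp add: bij_betw_same_card)
qed

text \<open>
  The Stallings graphs of the subgroups of size \<open>n\<close>, with vertex set and root normalised.
\<close>

definition rooted_graphs :: "'a set \<Rightarrow> nat \<Rightarrow> (nat \<times> 'a \<times> nat) set set" where
  "rooted_graphs A n = {E. admissible A {..<n} E 0}"

lemma rooted_graphs_is_graph: "E \<in> rooted_graphs A n \<Longrightarrow> is_graph A {..<n} E"
  by (simp add: rooted_graphs_def admissible_def)

lemma finite_rooted_graphs: "finite A \<Longrightarrow> finite (rooted_graphs A n)"
  by (rule finite_subset[OF _ finite_graphs[of A "{..<n}" "\<lambda>_. True"]])
    (auto simp: rooted_graphs_def admissible_def)

lemma subgroups_of_size_eq_image:
  assumes "finite A"
  shows "subgroups_of_size A n = (\<lambda>E. loop_subgroup A E 0) ` rooted_graphs A n"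
proof (intro equalityI subsetI)
  fix H assume "H \<in> subgroups_of_size A n"
  then have H: "finitely_generated_subgroup A H" "subgroup_size A H = n"
    by (auto simp: subgroups_of_size_def)
  note HG = finitely_generated_subset_carrier[OF H(1)]
  obtain V E p where V: "stallings_graph A H = (V, E, p)" "is_stallings_graph A H V E p"
    using stallings_graph_is_stallings_graph[OF H(1) assms] .
  have n: "card V = n" using H(2) V(1) by (simp add: subgroup_size_def)
  have fin: "finite V" "p \<in> V" using V(2) by (auto simp: is_stallings_graph_def admissible_def)
  obtain h where h: "bij_betw h V {0..<n}" using ex_bij_betw_finite_nat[OF fin(1)] n by blast
  have hp: "h p \<in> {..<n}" using h fin(2) by (auto simp: bij_betw_def)
  \<comment> \<open>A swap moves the image of the root to \<open>0\<close>.\<close>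
  define \<tau> where "\<tau> = Transposition.transpose (h p) 0"
  have "\<tau> ` {..<n} = {..<n}"
    unfolding \<tau>_def using hp by (intro permutes_image permutes_swap_id) auto
  moreover have "inj \<tau>" by (simp add: \<tau>_def)
  ultimately have f: "inj_on (\<tau> \<circ> h) V" "(\<tau> \<circ> h) ` V = {..<n}"
    using h unfolding bij_betw_def image_comp[symmetric] lessThan_atLeast0
    by (auto intro: comp_inj_on inj_on_subset)
  have "is_stallings_graph A H {..<n} (relabel (\<tau> \<circ> h) E) 0"
    using is_stallings_graph_relabel[OF V(2) HG assms f(1)] unfolding f(2) by (simp add: \<tau>_def)
  then show "H \<in> (\<lambda>E. loop_subgroup A E 0) ` rooted_graphs A n"
    unfolding is_stallings_graph_iff[OF HG] rooted_graphs_def by blast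
next
  fix H assume "H \<in> (\<lambda>E. loop_subgroup A E 0) ` rooted_graphs A n"
  then obtain E where E: "admissible A {..<n} E 0" "H = loop_subgroup A E 0"
    by (auto simp: rooted_graphs_def)
  have g: "is_graph A {..<n} E" "is_connected {..<n} E" "0 \<in> {..<n}" using E(1) by (auto simp: admissible_def)
  have fg: "finitely_generated_subgroup A H"
    unfolding E(2) using finite_graph_edges[OF g(1) assms] g
    by (intro loop_subgroup_finitely_generated[of A "{..<n}"]) auto
  have "is_stallings_graph A H {..<n} E 0"
    unfolding is_stallings_graph_iff[OF finitely_generated_subset_carrier[OF fg]] using E by blast
  then have "subgroup_size A H = n" using subgroup_size_eq[OF fg assms] by fastforce
  then show "H \<in> subgroups_of_size A n" using fg by (simp add: subgroups_of_size_def)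
qed

text \<open>
  An isomorphism of deterministic connected graphs is determined by its value at one vertex.
\<close>

lemma relabel_rigid:
  assumes "is_graph A V E" "is_connected V E" "p \<in> V" "is_graph A W (relabel f E)"
    "relabel f E = relabel g E" "f p = g p" "v \<in> V"
  shows "f v = g v"
proof -
  obtain w where "reads E p w v" using connected_reads[OF assms(1,2,3,7)] .
  then have "reads (relabel f E) (f p) w (f v)" "reads (relabel f E) (f p) w (g v)"
    using reads_relabel[of E p w v f] reads_relabel[of E p w v g] unfolding assms(5,6) by blast+
  then show ?thesis by (rule reads_unique[OF assms(4)])
qed

text \<open>
  By uniqueness the graphs of the same subgroup are the relabellings of \<open>E\<close> by permutations fixing the root \<open>0\<close>, and
  by rigidity different permutations give different graphs.
\<close>

lemma card_relabellings:
  assumes "finite A" "E \<in> rooted_graphs A n"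
  shows "card {F \<in> rooted_graphs A n. loop_subgroup A F 0 = loop_subgroup A E 0} = fact (n - 1)"
proof -
  let ?P = "{\<pi>. \<pi> permutes {1..<n}}"
  have E: "admissible A {..<n} E 0" "is_graph A {..<n} E" "is_connected {..<n} E" "0 \<in> {..<n}"
    using assms(2) by (auto simp: rooted_graphs_def admissible_def)
  have perm: "\<pi> permutes {..<n}" "\<pi> 0 = 0" if "\<pi> permutes {1..<n}" for \<pi>
  proof -
    show "\<pi> permutes {..<n}" by (rule permutes_subset[OF that]) auto
    show "\<pi> 0 = 0" using permutes_not_in[OF that, of 0] by simp
  qed
  have relabel: "relabel \<pi> E \<in> {F \<in> rooted_graphs A n. loop_subgroup A F 0 = loop_subgroup A E 0}"
    if "\<pi> \<in> ?P" for \<pi>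
  proof -
    have \<pi>: "\<pi> permutes {1..<n}" using that by simp
    have inj: "inj_on \<pi> {..<n}" using permutes_inj_on[OF \<pi>] .
    have "admissible A (\<pi> ` {..<n}) (relabel \<pi> E) (\<pi> 0)" by (rule admissible_relabel[OF E(1) assms(1) inj])
    moreover have "loop_subgroup A (relabel \<pi> E) (\<pi> 0) = loop_subgroup A E 0"
      by (rule loop_subgroup_relabel[OF E(2) inj E(4)])
    ultimately show ?thesis
      using permutes_image[OF perm(1)[OF \<pi>]] perm(2)[OF \<pi>] by (simp add: rooted_graphs_def)
  qed
  have "bij_betw (\<lambda>\<pi>. relabel \<pi> E) ?P {F \<in> rooted_graphs A n. loop_subgroup A F 0 = loop_subgroup A E 0}"
    unfolding bij_betw_def
  proof (intro conjI equalityI)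
    show "inj_on (\<lambda>\<pi>. relabel \<pi> E) ?P"
    proof (rule inj_onI)
      fix \<pi> \<rho> assume \<pi>: "\<pi> \<in> ?P" and \<rho>: "\<rho> \<in> ?P" and eq: "relabel \<pi> E = relabel \<rho> E"
      have g: "is_graph A {..<n} (relabel \<pi> E)" using relabel[OF \<pi>] rooted_graphs_is_graph by blast
      have p: "\<pi> permutes {1..<n}" "\<rho> permutes {1..<n}" using \<pi> \<rho> by simp_all
      show "\<pi> = \<rho>"
      proof
        fix v show "\<pi> v = \<rho> v"
        proof (cases "v < n")
          case True
          then show ?thesis
            using relabel_rigid[OF E(2,3,4) g eq] perm(2)[OF p(1)] perm(2)[OF p(2)] by simp
        next
          case False
          then show ?thesis using permutes_not_in[OF p(1), of v] permutes_not_in[OF p(2), of v] by simp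
        qed
      qed
    qed
    show "(\<lambda>\<pi>. relabel \<pi> E) ` ?P \<subseteq> {F \<in> rooted_graphs A n. loop_subgroup A F 0 = loop_subgroup A E 0}"
      using relabel by blast
    show "{F \<in> rooted_graphs A n. loop_subgroup A F 0 = loop_subgroup A E 0} \<subseteq> (\<lambda>\<pi>. relabel \<pi> E) ` ?P"
    proof
      fix F assume "F \<in> {F \<in> rooted_graphs A n. loop_subgroup A F 0 = loop_subgroup A E 0}"
      then have F: "admissible A {..<n} F 0" "loop_subgroup A E 0 = loop_subgroup A F 0"
        by (auto simp: rooted_graphs_def)
      obtain f where f: "bij_betw f {..<n} {..<n}" "f 0 = 0" "relabel f E = F"
        using stallings_graph_unique[OF E(1) F(1) assms(1) F(2)] .
      define \<pi> where "\<pi> v = (if v < n then f v else v)" for v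
      have "bij_betw \<pi> {..<n} {..<n}"
        using f(1) by (subst bij_betw_cong[of _ _ f]) (auto simp: \<pi>_def)
      then have "\<pi> permutes {..<n}" by (rule bij_imp_permutes) (simp add: \<pi>_def)
      then have "\<pi> permutes {1..<n}"
      proof (rule permutes_superset)
        fix v assume "v \<in> {..<n} - {1..<n}"
        then show "\<pi> v = v" using f(2) by (cases "v = 0") (auto simp: \<pi>_def)
      qed
      moreover have "relabel \<pi> E = relabel f E"
        unfolding relabel_def using E(2) by (intro image_cong) (auto simp: \<pi>_def is_graph_def)
      ultimately show "F \<in> (\<lambda>\<pi>. relabel \<pi> E) ` ?P" using f(3) by blast
    qed
  qed
  then have "card {F \<in> rooted_graphs A n. loop_subgroup A F 0 = loop_subgroup A E 0} = card ?P"
    by (rule bij_betw_same_card[symmetric])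
  also have "\<dots> = fact (n - 1)" by (rule card_permutations) auto
  finally show ?thesis .
qed

text \<open>
  Each subgroup is counted \<open>(n - 1)!\<close> times on the left.
\<close>

lemma card_rooted_graphs:
  assumes "finite A"
  shows "card {E \<in> rooted_graphs A n. P (loop_subgroup A E 0)} =
    fact (n - 1) * card {H \<in> subgroups_of_size A n. P H}"
proof -
  let ?L = "\<lambda>E. loop_subgroup A E 0" and ?R = "rooted_graphs A n"
  have finR: "finite ?R" by (rule finite_rooted_graphs[OF assms])
  have finS: "finite (subgroups_of_size A n)" using finR by (simp add: subgroups_of_size_eq_image[OF assms])
  have "{E \<in> ?R. P (?L E)} = (\<Union>H\<in>{H \<in> subgroups_of_size A n. P H}. {E \<in> ?R. ?L E = H})"
    by (auto simp: subgroups_of_size_eq_image[OF assms])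
  also have "card \<dots> = (\<Sum>H\<in>{H \<in> subgroups_of_size A n. P H}. card {E \<in> ?R. ?L E = H})"
    using finR finS by (intro card_UN_disjoint) auto
  also have "\<dots> = (\<Sum>H\<in>{H \<in> subgroups_of_size A n. P H}. fact (n - 1))"
    using card_relabellings[OF assms] by (intro sum.cong) (auto simp: subgroups_of_size_eq_image[OF assms])
  finally show ?thesis by simp
qed

lemma rooted_graphs_eq:
  assumes "0 < n"
  shows "{E \<in> rooted_graphs A n. P E} = {E. is_graph A {..<n} E \<and>
    (P E \<and> \<not> (\<not> is_connected {..<n} E \<or> (\<exists>v\<in>{..<n}. v \<noteq> 0 \<and> is_leaf E v)))}"
proof -
  have "E \<in> rooted_graphs A n \<longleftrightarrow> is_graph A {..<n} E \<and> is_connected {..<n} E \<and>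
      (\<forall>v\<in>{..<n}. v \<noteq> 0 \<longrightarrow> \<not> is_leaf E v)" for E
    using assms by (simp add: rooted_graphs_def admissible_def)
  then show ?thesis by blast
qed

lemma prob_avoids_eq:
  assumes "finite A" "rooted_graphs A n \<noteq> {}"
  shows "measure_pmf.prob (random_subgroup A n) {H. avoids_generator_conjugates A H} =
    card {E \<in> rooted_graphs A n. loop_free E} / card (rooted_graphs A n)"
proof -
  let ?S = "subgroups_of_size A n"
  have S: "finite ?S" "?S \<noteq> {}"
    using assms finite_rooted_graphs by (auto simp: subgroups_of_size_eq_image[OF assms(1)])
  have "card {E \<in> rooted_graphs A n. loop_free E} =
      card {E \<in> rooted_graphs A n. avoids_generator_conjugates A (loop_subgroup A E 0)}"
    by (rule arg_cong[where f = card]) 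
      (auto simp: rooted_graphs_def loop_free_def avoids_generator_conjugates_iff_loop_free)
  also have "\<dots> = fact (n - 1) * card {H \<in> ?S. avoids_generator_conjugates A H}"
    by (rule card_rooted_graphs[OF assms(1)])
  finally have num: "card {E \<in> rooted_graphs A n. loop_free E} =
    fact (n - 1) * card {H \<in> ?S. avoids_generator_conjugates A H}" .
  have den: "card (rooted_graphs A n) = fact (n - 1) * card ?S"
    using card_rooted_graphs[OF assms(1), of n "\<lambda>_. True"] by simp
  have "measure_pmf.prob (random_subgroup A n) {H. avoids_generator_conjugates A H} =
      card {H \<in> ?S. avoids_generator_conjugates A H} / card ?S"
    unfolding random_subgroup_def measure_pmf_of_set[OF S(2,1)] by (simp add: Int_def)
  then show ?thesis unfolding num den by simp
qed

section \<open>The limit\<close>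

theorem theorem5p1:
  fixes A :: "'a set" and r :: nat
  assumes "r \<ge> 2" and "finite A" and "card A = r"
  shows "(\<lambda>n. measure_pmf.prob (random_subgroup A n) {H. avoids_generator_conjugates A H})
           \<longlonglongrightarrow> exp (- real r)"
proof -
  let ?f = "graph_fraction A"
  define bad where "bad n E \<longleftrightarrow> \<not> is_connected {..<n} E \<or> (\<exists>v\<in>{..<n}. v \<noteq> 0 \<and> is_leaf E v)"
    for n and E :: "(nat \<times> 'a \<times> nat) set"
  define good where "good P n = ?f n (\<lambda>E. P E \<and> \<not> bad n E)" for P n
  have r: "2 \<le> card A" using assms by simp
  define b where "b n = ?f n (\<lambda>E. \<not> is_connected {..<n} E) + ?f n (\<lambda>E. \<exists>v\<in>{..<n}. is_leaf E v)" for n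
  have b: "b \<longlonglongrightarrow> 0"
    unfolding b_def
    using tendsto_add[OF disconnected_graph_fraction[OF assms(2) r] leaf_graph_fraction[OF assms(2) r]] by simp
  have bad_le: "?f n (bad n) \<le> b n" for n
  proof -
    have "?f n (bad n) \<le> ?f n (\<lambda>E. \<not> is_connected {..<n} E \<or> (\<exists>v\<in>{..<n}. is_leaf E v))"
      using assms(2) by (intro graph_fraction_mono) (auto simp: bad_def)
    also have "\<dots> \<le> b n" unfolding b_def by (rule graph_fraction_disj_le[OF assms(2)])
    finally show ?thesis .
  qed
  \<comment> \<open>Removing an event of vanishing probability does not change a limit.\<close>
  have good: "good P \<longlonglongrightarrow> c" if "(\<lambda>n. ?f n P) \<longlonglongrightarrow> c" for P c
  proof (rule tendsto_sandwich)
    show "(\<lambda>n. ?f n P - b n) \<longlonglongrightarrow> c" using tendsto_diff[OF that b] by simp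
    show "(\<lambda>n. ?f n P) \<longlonglongrightarrow> c" by (rule that)
    show "\<forall>\<^sub>F n in sequentially. good P n \<le> ?f n P"
      unfolding good_def using assms(2) by (intro always_eventually allI graph_fraction_mono) auto
    have "?f n P \<le> good P n + b n" for n
    proof -
      have "?f n P \<le> ?f n (\<lambda>E. (P E \<and> \<not> bad n E) \<or> bad n E)"
        using assms(2) by (intro graph_fraction_mono) auto
      also have "\<dots> \<le> good P n + ?f n (bad n)"
        unfolding good_def by (rule graph_fraction_disj_le[OF assms(2)])
      finally show ?thesis using bad_le[of n] by simp
    qed
    then show "\<forall>\<^sub>F n in sequentially. ?f n P - b n \<le> good P n"
      by (intro always_eventually allI) (simp add: algebra_simps)
  qed
  have "?f n (\<lambda>_. True) = 1" for n
  proof -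
    have "?f n (\<lambda>_. False) = 0" by (simp add: graph_fraction_def)
    then show ?thesis using graph_fraction_split[OF assms(2), of n "\<lambda>_. True"] by simp
  qed
  then have "good (\<lambda>_. True) \<longlonglongrightarrow> 1" by (intro good) simp
  moreover have "good loop_free \<longlonglongrightarrow> exp (- real (card A))"
    by (rule good[OF loop_free_graph_fraction[OF assms(2)]])
  ultimately have lim: "(\<lambda>n. good loop_free n / good (\<lambda>_. True) n) \<longlonglongrightarrow> exp (- real r) / 1"
    unfolding assms(3) by (intro tendsto_divide) auto
  have card_good: "good P n = card {E \<in> rooted_graphs A n. P E} / pinj_count n n ^ card A" if "0 < n" for P n
    unfolding rooted_graphs_eq[OF that] good_def bad_def graph_fraction_def by simp
  have "\<forall>\<^sub>F n in sequentially. 0 < good (\<lambda>_. True) n"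
    using \<open>good (\<lambda>_. True) \<longlonglongrightarrow> 1\<close> by (rule order_tendstoD) simp
  then have "\<forall>\<^sub>F n in sequentially. good loop_free n / good (\<lambda>_. True) n =
      measure_pmf.prob (random_subgroup A n) {H. avoids_generator_conjugates A H}"
    using eventually_gt_at_top[of 0]
  proof eventually_elim
    case (elim n)
    then have "rooted_graphs A n \<noteq> {}" using card_good[of n "\<lambda>_. True"] by auto
    then show ?case
      using prob_avoids_eq[OF assms(2)] card_good[OF elim(2)] pinj_count_pos[of n n] by simp
  qed
  with lim show ?thesis by (simp add: Lim_transform_eventually)
qed

end
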